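(* Let $F$ be a field of positive characteristic $p$, let $G$ and $H$ be finite $p$-groups, and let $E$ be a finite elementary abelian $p$-group. If $F[E\times G]\cong F[E\times H]$ as $F$-algebras, then $FG\cong FH$ as $F$-algebras.
   Context: For a field $F$ and a finite group $X$, $FX = F[X]$ denotes the group algebra of $X$ over $F$. An elementary abelian $p$-group is an abelian group in which every element $x$ satisfies $x^p=1$. *)

theory Defs
  imports "HOL-Algebra.Algebra"
begin

definition ring_characteristic :: "('f, 'k) ring_scheme \<Rightarrow> nat" where
  "ring_characteristic R = group.ord (add_monoid R) \<one>\<^bsub>R\<^esub>"
  \<comment> \<open>\<^const>\<open>group.ord\<close> is 0 on elements of infinite order, so this is 0 in characteristic zero.\<close>

definition finite_p_group :: "nat \<Rightarrow> ('g, 'm) monoid_scheme \<Rightarrow> bool" where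
  "finite_p_group p G \<longleftrightarrow> group G \<and> finite (carrier G) \<and> (\<exists>n. order G = p ^ n)"

definition elementary_abelian :: "nat \<Rightarrow> ('g, 'm) monoid_scheme \<Rightarrow> bool" where
  "elementary_abelian p E \<longleftrightarrow>
     comm_group E \<and> (\<forall>x\<in>carrier E. x [^]\<^bsub>E\<^esub> p = \<one>\<^bsub>E\<^esub>)"

text \<open>
  For a finite group \<open>G\<close> the formal sum of the terms \<open>f g \<cdot> g\<close> is encoded as the coefficient function
  \<open>f\<close>, extensional on the carrier of \<open>G\<close>, and multiplication becomes convolution.
  No finite-support condition is imposed, so this is the group algebra for finite \<open>G\<close> only.
\<close>

definition group_algebra ::
  "('f, 'k) ring_scheme \<Rightarrow> ('g, 'm) monoid_scheme \<Rightarrow> ('f, 'g \<Rightarrow> 'f) module" where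
  "group_algebra F G =
     \<lparr> carrier = carrier G \<rightarrow>\<^sub>E carrier F,
       monoid.mult = (\<lambda>a b. \<lambda>x\<in>carrier G. \<Oplus>\<^bsub>F\<^esub>y\<in>carrier G. a y \<otimes>\<^bsub>F\<^esub> b (inv\<^bsub>G\<^esub> y \<otimes>\<^bsub>G\<^esub> x)),
       one = (\<lambda>x\<in>carrier G. if x = \<one>\<^bsub>G\<^esub> then \<one>\<^bsub>F\<^esub> else \<zero>\<^bsub>F\<^esub>),
       ring.zero = (\<lambda>x\<in>carrier G. \<zero>\<^bsub>F\<^esub>),
       add = (\<lambda>a b. \<lambda>x\<in>carrier G. a x \<oplus>\<^bsub>F\<^esub> b x),
       module.smult = (\<lambda>c a. \<lambda>x\<in>carrier G. c \<otimes>\<^bsub>F\<^esub> a x) \<rparr>"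

text \<open>
  The locale \<^locale>\<open>algebra\<close> covers only commutative algebras, so isomorphism of (unital, associative)
  \<open>F\<close>-algebras is stated directly on module records.
\<close>

definition algebra_iso ::
  "('f, 'k) ring_scheme \<Rightarrow> ('f, 'a, 'm) module_scheme \<Rightarrow> ('f, 'b, 'n) module_scheme \<Rightarrow> ('a \<Rightarrow> 'b) set"
where
  "algebra_iso F A B =
     {h \<in> ring_iso A B. \<forall>c\<in>carrier F. \<forall>x\<in>carrier A. h (c \<odot>\<^bsub>A\<^esub> x) = c \<odot>\<^bsub>B\<^esub> h x}"

definition algebra_isomorphic ::
  "('f, 'k) ring_scheme \<Rightarrow> ('f, 'a, 'm) module_scheme \<Rightarrow> ('f, 'b, 'n) module_scheme \<Rightarrow> bool"
where
  "algebra_isomorphic F A B \<longleftrightarrow> algebra_iso F A B \<noteq> {}"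

end

theory Submission
  imports Defs
begin

text \<open>
  A cyclic group \<open>\<langle>k\<rangle>\<close> of order \<open>p\<close> has group algebra \<open>F[x]/(x\<^sup>p)\<close> with \<open>x = k - 1\<close>, so for
  \<open>P = \<langle>k\<rangle> \<times> Q\<close> the algebra \<open>R = F[P]\<close> is \<open>A[x]/(x\<^sup>p)\<close> with \<open>A = F[Q]\<close> and \<open>x\<close> central. As \<open>E\<close> is a
  product of such cyclic groups, it suffices to cancel one of them at a time: if
  \<open>A[x]/(x\<^sup>p) \<cong> B[y]/(y\<^sup>p)\<close> for group algebras \<open>A\<close>, \<open>B\<close> of finite \<open>p\<close>-groups, then \<open>A \<cong> B\<close>
  (\<open>truncated_extension_cancel\<close>).

  Regard both presentations as presentations of one ring \<open>R\<close>. Let \<open>z\<close> be a central element with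
  \<open>z\<^sup>p = 0\<close>, expanded in powers of \<open>x\<close> as \<open>z = a\<^sub>0 + a\<^sub>1 x + \<dots>\<close>. If \<open>a\<^sub>1\<close> is a unit of \<open>A\<close>, then \<open>z\<close> can
  play the role of \<open>x\<close>: the composite \<open>A \<rightarrow> R \<rightarrow> R/zR\<close> is bijective
  (\<open>linear_unit_complementary\<close>). For surjectivity, \<open>a\<^sub>1\<^sup>-\<^sup>1 (z - a\<^sub>0)\<close> agrees with \<open>x\<close> up to higher
  powers of the nilpotent element \<open>x\<close>; for injectivity, \<open>z\<close> is congruent to \<open>x\<close> times a unit up to
  the nilpotent element \<open>a\<^sub>0\<close>. If \<open>z\<close> has unit linear coefficient with respect to \<open>x\<close> and also with
  respect to \<open>y\<close>, then \<open>A \<cong> R/zR \<cong> B\<close>.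

  Such a \<open>z\<close> exists because \<open>A\<close> and \<open>B\<close> are local. The element \<open>x\<close> has linear coefficient 1 with respect to
  itself, and so does \<open>y\<close>. If the linear coefficient of \<open>y\<close> with respect to \<open>x\<close> is a unit, take \<open>z = y\<close>;
  if that of \<open>x\<close> with respect to \<open>y\<close> is a unit, take \<open>z = x\<close>; otherwise take \<open>z = x + y\<close>, whose linear coefficients are of the form 1 plus a non-unit. In
  characteristic \<open>p\<close> this sum still satisfies \<open>z\<^sup>p = 0\<close>.

  Locality of the group algebra of a finite \<open>p\<close>-group (\<open>p_group_algebra_local\<close>) holds because
  every element of augmentation zero is nilpotent (\<open>augmentation_kernel_nil\<close>): divide out a
  central element \<open>k \<noteq> 1\<close>, and use that the kernel of \<open>F[G] \<rightarrow> F[G/\<langle>k\<rangle>]\<close> is generated by the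
  central nilpotent element \<open>k - 1\<close>.
\<close>

section \<open>Frobenius identities and nilpotent elements in noncommutative rings\<close>

text \<open>
  Group algebras need not be commutative, but the elements to be raised to powers below are central.
\<close>

lemma (in ring) binomial_commuting:
  assumes x: "x \<in> carrier R" and y: "y \<in> carrier R" and xy: "x \<otimes> y = y \<otimes> x"
  shows "(x \<oplus> y) [^] n = (\<Oplus>i\<in>{..n}. add_pow R (n choose i) (x [^] i \<otimes> y [^] (n - i)))"
proof (induction n)
  case 0
  then show ?case using x y by simp
next
  case (Suc n)
  have yx: "y [^] m \<otimes> x = x \<otimes> y [^] m" for m :: nat
    using x y xy by (simp add: group_commutes_pow)
  define f where "f = (\<lambda>i. add_pow R (n choose i) (x [^] Suc i \<otimes> y [^] (n - i)))"
  define g where "g = (\<lambda>i. add_pow R (n choose Suc i) (x [^] Suc i \<otimes> y [^] (n - i)))"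
  define h where "h = (\<lambda>i. add_pow R (n choose i) (x [^] i \<otimes> y [^] (Suc n - i)))"
  have fcl: "f \<in> A \<rightarrow> carrier R" and gcl: "g \<in> A \<rightarrow> carrier R" and hcl: "h \<in> A \<rightarrow> carrier R" for A
    using x y by (auto simp: f_def g_def h_def)
  have tcl: "(\<lambda>i. add_pow R (n choose i) (x [^] i \<otimes> y [^] (n - i))) \<in> {..n} \<rightarrow> carrier R"
    using x y by auto
  have hsum: "(\<Oplus>i\<in>{..n}. h i) = (\<Oplus>i\<in>{..n}. g i) \<oplus> y [^] Suc n"
  proof -
    have "(\<Oplus>i\<in>{..Suc n}. h i) = (\<Oplus>i\<in>{..n}. h i)"
      using hcl x y finsum_Suc[OF hcl] by (simp add: h_def binomial_eq_0)
    moreover have "(\<Oplus>i\<in>{..Suc n}. h i) = (\<Oplus>i\<in>{..n}. h (Suc i)) \<oplus> h 0"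
      by (rule finsum_Suc2[OF hcl])
    moreover have "h (Suc i) = g i" for i by (simp add: h_def g_def)
    moreover have "h 0 = y [^] Suc n" using x y by (simp add: h_def)
    ultimately show ?thesis by simp
  qed
  have step: "add_pow R (Suc n choose Suc i) (x [^] Suc i \<otimes> y [^] (Suc n - Suc i)) = f i \<oplus> g i" for i
    using x y by (simp add: f_def g_def add.nat_pow_mult del: nat_pow_Suc)
  have rhs: "(\<Oplus>i\<in>{..Suc n}. add_pow R (Suc n choose i) (x [^] i \<otimes> y [^] (Suc n - i)))
      = (\<Oplus>i\<in>{..n}. f i \<oplus> g i) \<oplus> y [^] Suc n"
  proof -
    have c: "(\<lambda>i. add_pow R (Suc n choose i) (x [^] i \<otimes> y [^] (Suc n - i))) \<in> S \<rightarrow> carrier R" for S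
      using x y by auto
    show ?thesis unfolding finsum_Suc2[OF c] step using y by simp
  qed
  have fx: "(add_pow R (n choose i) (x [^] i \<otimes> y [^] (n - i))) \<otimes> x = f i" for i
    using x y by (simp add: f_def add_pow_ldistr m_assoc yx)
  have hy: "(add_pow R (n choose i) (x [^] i \<otimes> y [^] (n - i))) \<otimes> y = h i" if "i \<in> {..n}" for i
    using x y that by (simp add: h_def add_pow_ldistr m_assoc Suc_diff_le)
  have "(x \<oplus> y) [^] Suc n =
      (\<Oplus>i\<in>{..n}. add_pow R (n choose i) (x [^] i \<otimes> y [^] (n - i))) \<otimes> x
    \<oplus> (\<Oplus>i\<in>{..n}. add_pow R (n choose i) (x [^] i \<otimes> y [^] (n - i))) \<otimes> y"
    using x y tcl Suc by (simp add: r_distr finsum_closed)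
  also have "\<dots> = (\<Oplus>i\<in>{..n}. f i) \<oplus> (\<Oplus>i\<in>{..n}. h i)"
  proof (intro arg_cong2[where f = "add R"])
    show "(\<Oplus>i\<in>{..n}. add_pow R (n choose i) (x [^] i \<otimes> y [^] (n - i))) \<otimes> x = (\<Oplus>i\<in>{..n}. f i)"
      by (subst finsum_ldistr[OF _ x tcl]) (simp_all add: fx)
    show "(\<Oplus>i\<in>{..n}. add_pow R (n choose i) (x [^] i \<otimes> y [^] (n - i))) \<otimes> y = (\<Oplus>i\<in>{..n}. h i)"
      by (subst finsum_ldistr[OF _ y tcl], simp, rule finsum_cong'[OF refl hcl hy]) auto
  qed
  also have "\<dots> = (\<Oplus>i\<in>{..n}. f i \<oplus> g i) \<oplus> y [^] Suc n"
    using fcl gcl y by (simp add: hsum finsum_addf a_assoc)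
  finally show ?case by (simp only: rhs)
qed

lemma (in ring) frobenius_commuting:
  fixes p :: nat
  assumes p: "Factorial_Ring.prime p" and char: "add_pow R p \<one> = \<zero>"
    and x: "x \<in> carrier R" and y: "y \<in> carrier R" and xy: "x \<otimes> y = y \<otimes> x"
  shows "(x \<oplus> y) [^] p = x [^] p \<oplus> y [^] p"
proof -
  have pz: "add_pow R m a = \<zero>" if a: "a \<in> carrier R" and m_dvd: "p dvd m" for a and m :: nat
  proof -
    obtain k where m: "m = p * k" using m_dvd by auto
    have "add_pow R m a = add_pow R k ((add_pow R p \<one>) \<otimes> a)"
      using a m by (simp add: add_pow_ldistr add.nat_pow_pow)
    then show ?thesis using char a by simp
  qed
  obtain m where m: "p = Suc (Suc m)"
    using p by (metis One_nat_def not0_implies_Suc not_prime_0 not_prime_1)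
  let ?t = "\<lambda>i. add_pow R (p choose i) (x [^] i \<otimes> y [^] (p - i))"
  have mid: "?t (Suc i) = \<zero>" if "i \<in> {..m}" for i
    using that x y m by (intro pz dvd_choose_prime) (use p in auto)
  have "(x \<oplus> y) [^] p = (\<Oplus>i\<in>{..Suc (Suc m)}. ?t i)"
    unfolding m by (rule binomial_commuting[OF x y xy])
  also have "\<dots> = x [^] p \<oplus> ((\<Oplus>i\<in>{..m}. ?t (Suc i)) \<oplus> y [^] p)"
  proof -
    have c: "?t \<in> S \<rightarrow> carrier R" for S using x y by auto
    have e1: "finsum R ?t {..Suc (Suc m)} = ?t p \<oplus> finsum R ?t {..Suc m}"
      using finsum_Suc[OF c, of "Suc m"] unfolding m .
    have e2: "finsum R ?t {..Suc m} = (\<Oplus>i\<in>{..m}. ?t (Suc i)) \<oplus> ?t 0"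
      by (rule finsum_Suc2[OF c])
    have e3: "?t p = x [^] p" "?t 0 = y [^] p" using x y by simp_all
    show ?thesis unfolding e1 e2 e3 ..
  qed
  also have "(\<Oplus>i\<in>{..m}. ?t (Suc i)) = \<zero>"
    using mid by (intro add.finprod_one_eqI) auto
  finally show ?thesis using x y by simp
qed

lemma (in ring) frobenius_power_commuting:
  fixes p :: nat
  assumes p: "Factorial_Ring.prime p" and char: "add_pow R p \<one> = \<zero>"
    and x: "x \<in> carrier R" and y: "y \<in> carrier R" and xy: "x \<otimes> y = y \<otimes> x"
  shows "(x \<oplus> y) [^] (p ^ n) = x [^] (p ^ n) \<oplus> y [^] (p ^ n)"
proof (induction n)
  case 0 then show ?case using x y by (simp add: nat_pow_eone)
next
  case (Suc n)
  have c: "x [^] (p ^ n) \<otimes> y [^] (p ^ n) = y [^] (p ^ n) \<otimes> x [^] (p ^ n)"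
    using x y xy by (metis group_commutes_pow nat_pow_closed)
  have "(x \<oplus> y) [^] (p ^ Suc n) = ((x \<oplus> y) [^] (p ^ n)) [^] p"
    using x y by (simp add: nat_pow_pow mult.commute)
  also have "\<dots> = (x [^] (p ^ n)) [^] p \<oplus> (y [^] (p ^ n)) [^] p"
    unfolding Suc using x y by (intro frobenius_commuting p char c) auto
  finally show ?case using x y by (simp add: nat_pow_pow mult.commute)
qed

text \<open>
  The geometric series in \<open>a\<close> terminates and is a two-sided inverse.
\<close>

lemma (in ring) one_minus_nilpotent_Unit:
  assumes a: "a \<in> carrier R" and nil: "a [^] (n::nat) = \<zero>"
  shows "\<one> \<ominus> a \<in> Units R"
proof -
  define s where "s k = (\<Oplus>i\<in>{..<k}. a [^] i)" for k :: nat
  have scl: "s k \<in> carrier R" for k unfolding s_def using a by (intro finsum_closed) auto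
  have s0: "s 0 = \<zero>" by (simp add: s_def)
  have sS: "s (Suc k) = a [^] k \<oplus> s k" for k
    unfolding s_def lessThan_Suc using a by (subst finsum_insert) auto
  have as: "a \<otimes> s k = s k \<otimes> a" for k
  proof (induction k)
    case 0 then show ?case using a by (simp add: s0)
  next
    case (Suc k)
    have "a \<otimes> a [^] k = a [^] k \<otimes> a" using a nat_pow_Suc2[of a k] by simp
    then show ?case using Suc a scl by (simp add: sS r_distr l_distr)
  qed
  have l: "(\<one> \<ominus> a) \<otimes> s k = \<one> \<ominus> a [^] k" for k
  proof (induction k)
    case 0 then show ?case using a by (simp add: s0 minus_eq r_neg)
  next
    case (Suc k)
    have "(\<one> \<ominus> a) \<otimes> s (Suc k) = (\<one> \<ominus> a) \<otimes> a [^] k \<oplus> (\<one> \<ominus> a [^] k)"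
      using a scl Suc by (simp add: sS r_distr)
    also have "(\<one> \<ominus> a) \<otimes> a [^] k = a [^] k \<ominus> a [^] Suc k"
      using a nat_pow_Suc2[OF a, of k] by (simp add: minus_eq l_distr l_minus)
    also have "(a [^] k \<ominus> a [^] Suc k) \<oplus> (\<one> \<ominus> a [^] k) = \<one> \<ominus> a [^] Suc k"
    proof -
      have "u \<in> carrier R \<Longrightarrow> v \<in> carrier R \<Longrightarrow> (u \<ominus> v) \<oplus> (\<one> \<ominus> u) = \<one> \<ominus> v" for u v by algebra
      then show ?thesis using a by simp
    qed
    finally show ?case .
  qed
  have "s n \<otimes> (\<one> \<ominus> a) = (\<one> \<ominus> a) \<otimes> s n"
    using a scl as by (simp add: minus_eq r_distr l_distr l_minus r_minus)
  then show ?thesis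
    using l[of n] nil a scl by (auto simp: Units_def minus_eq intro!: exI[of _ "s n"])
qed

section \<open>Truncated polynomial extensions and their cancellation\<close>

text \<open>
  The compatibility axiom makes left multiplication by a fixed ring element linear over \<open>F\<close>, so that
  the ideal generated by a central element is a subspace.
\<close>

locale unital_algebra = module F A + ring A for F (structure) and A (structure) +
  assumes smult_mult_right: "\<lbrakk>c \<in> carrier F; a \<in> carrier A; b \<in> carrier A\<rbrakk>
    \<Longrightarrow> c \<odot>\<^bsub>A\<^esub> (a \<otimes>\<^bsub>A\<^esub> b) = a \<otimes>\<^bsub>A\<^esub> (c \<odot>\<^bsub>A\<^esub> b)"

definition algebra_hom where
  "algebra_hom F A B =
     {h \<in> ring_hom A B. \<forall>c\<in>carrier F. \<forall>x\<in>carrier A. h (c \<odot>\<^bsub>A\<^esub> x) = c \<odot>\<^bsub>B\<^esub> h x}"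

text \<open>
  For central \<open>z\<close> this says that the composite \<open>A \<rightarrow> R \<rightarrow> R/zR\<close> is bijective, expressed on
  elements of \<open>A\<close> and \<open>R\<close>.
\<close>

definition complementary_embedding where
  "complementary_embedding A R \<iota> z \<longleftrightarrow>
     (\<forall>r\<in>carrier R. \<exists>a\<in>carrier A. \<exists>s\<in>carrier R. r = \<iota> a \<oplus>\<^bsub>R\<^esub> z \<otimes>\<^bsub>R\<^esub> s) \<and>
     (\<forall>a\<in>carrier A. \<forall>s\<in>carrier R. \<iota> a = z \<otimes>\<^bsub>R\<^esub> s \<longrightarrow> a = \<zero>\<^bsub>A\<^esub>)"

text \<open>
  The situation \<open>R = A[x]/(x\<^sup>p)\<close>, with \<open>\<iota>\<close> the inclusion of constants and \<open>\<eta>\<close> the evaluation at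
  \<open>x = 0\<close>. The last assumption is freeness of \<open>R\<close> over \<open>A\<close> in top degree: no nonzero constant is
  annihilated by \<open>x\<^sup>p\<^sup>-\<^sup>1\<close>.
\<close>

locale truncated_extension = A: ring A + R: ring R for A (structure) and R (structure) +
  fixes \<iota> \<eta> x and p :: nat
  assumes \<iota>_hom: "\<iota> \<in> ring_hom A R" and \<eta>_hom: "\<eta> \<in> ring_hom R A"
    and retraction: "a \<in> carrier A \<Longrightarrow> \<eta> (\<iota> a) = a"
    and x_closed [simp]: "x \<in> carrier R"
    and x_central: "r \<in> carrier R \<Longrightarrow> x \<otimes>\<^bsub>R\<^esub> r = r \<otimes>\<^bsub>R\<^esub> x"
    and \<eta>_x: "\<eta> x = \<zero>\<^bsub>A\<^esub>"
    and \<eta>_kernel: "\<lbrakk>r \<in> carrier R; \<eta> r = \<zero>\<^bsub>A\<^esub>\<rbrakk> \<Longrightarrow> \<exists>s\<in>carrier R. r = x \<otimes>\<^bsub>R\<^esub> s"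
    and p_pos: "p > 0"
    and x_pow: "x [^]\<^bsub>R\<^esub> p = \<zero>\<^bsub>R\<^esub>"
    and top: "\<lbrakk>a \<in> carrier A; x [^]\<^bsub>R\<^esub> (p - 1) \<otimes>\<^bsub>R\<^esub> \<iota> a = \<zero>\<^bsub>R\<^esub>\<rbrakk> \<Longrightarrow> a = \<zero>\<^bsub>A\<^esub>"
begin

sublocale \<iota>: ring_hom_ring A R \<iota>
  using \<iota>_hom by (auto intro: ring_hom_ringI2 A.ring_axioms R.ring_axioms)

sublocale \<eta>: ring_hom_ring R A \<eta>
  using \<eta>_hom by (auto intro: ring_hom_ringI2 A.ring_axioms R.ring_axioms)

lemma decompose:
  assumes "r \<in> carrier R" obtains s where "s \<in> carrier R" "r = \<iota> (\<eta> r) \<oplus>\<^bsub>R\<^esub> x \<otimes>\<^bsub>R\<^esub> s"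
proof -
  have "\<eta> (r \<ominus>\<^bsub>R\<^esub> \<iota> (\<eta> r)) = \<zero>\<^bsub>A\<^esub>"
    using assms by (simp add: R.minus_eq retraction A.r_neg)
  then obtain s where s: "s \<in> carrier R" "r \<ominus>\<^bsub>R\<^esub> \<iota> (\<eta> r) = x \<otimes>\<^bsub>R\<^esub> s"
    using \<eta>_kernel assms by (metis R.minus_closed \<eta>.hom_closed \<iota>.hom_closed)
  then have "r = \<iota> (\<eta> r) \<oplus>\<^bsub>R\<^esub> x \<otimes>\<^bsub>R\<^esub> s"
    using assms by (metis R.add.m_comm R.add.inv_solve_right R.minus_eq R.minus_closed \<eta>.hom_closed \<iota>.hom_closed)
  then show ?thesis using that s by blast
qed

lemma x_mult_pow:
  assumes "r \<in> carrier R"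
  shows "(x \<otimes>\<^bsub>R\<^esub> r) [^]\<^bsub>R\<^esub> (n::nat) = x [^]\<^bsub>R\<^esub> n \<otimes>\<^bsub>R\<^esub> r [^]\<^bsub>R\<^esub> n"
  using assms by (intro R.pow_mult_distrib) (auto simp: x_central)

lemma \<eta>_pow: "r \<in> carrier R \<Longrightarrow> \<eta> (r [^]\<^bsub>R\<^esub> (n::nat)) = \<eta> r [^]\<^bsub>A\<^esub> n"
  by (induction n) auto

text \<open>
  Write \<open>a\<^sub>0 = \<eta> z\<close>, a nilpotent central element of \<open>A\<close>. If a nonzero constant lay in \<open>zR\<close>, then so would
  its products with powers of \<open>a\<^sub>0\<close>, and the last nonzero one among these is annihilated by \<open>a\<^sub>0\<close>. On such
  a constant \<open>b\<close> the element \<open>z = a\<^sub>0 + x r\<close> acts like \<open>x r\<close>; since \<open>b \<in> zR\<close> is annihilated by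
  \<open>z\<^sup>p\<^sup>-\<^sup>1\<close>, it is annihilated by \<open>x\<^sup>p\<^sup>-\<^sup>1 r\<^sup>p\<^sup>-\<^sup>1\<close>, whose leading coefficient is a unit; hence
  \<open>b = 0\<close>.
\<close>

lemma embedding_meets_trivially:
  assumes z: "z \<in> carrier R" and central: "\<And>r. r \<in> carrier R \<Longrightarrow> z \<otimes>\<^bsub>R\<^esub> r = r \<otimes>\<^bsub>R\<^esub> z"
    and z_pow: "z [^]\<^bsub>R\<^esub> p = \<zero>\<^bsub>R\<^esub>"
    and r: "r \<in> carrier R" "z = \<iota> (\<eta> z) \<oplus>\<^bsub>R\<^esub> x \<otimes>\<^bsub>R\<^esub> r" and unit: "\<eta> r \<in> Units A"
    and a: "a \<in> carrier A" and s: "s \<in> carrier R" "\<iota> a = z \<otimes>\<^bsub>R\<^esub> s"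
  shows "a = \<zero>\<^bsub>A\<^esub>"
proof -
  define a0 where "a0 = \<eta> z"
  have a0: "a0 \<in> carrier A" using z by (simp add: a0_def)
  have a0_central: "a0 \<otimes>\<^bsub>A\<^esub> b = b \<otimes>\<^bsub>A\<^esub> a0" if "b \<in> carrier A" for b
  proof -
    have "\<eta> (z \<otimes>\<^bsub>R\<^esub> \<iota> b) = \<eta> (\<iota> b \<otimes>\<^bsub>R\<^esub> z)" using central that by simp
    then show ?thesis using z that by (simp add: a0_def retraction)
  qed
  have a0_pow: "a0 [^]\<^bsub>A\<^esub> p = \<zero>\<^bsub>A\<^esub>"
    using \<eta>_pow[OF z, of p] z_pow by (simp add: a0_def)
  \<comment> \<open>The case of a constant annihilated by \<open>a0\<close>, to which the induction on the exponent of \<open>a0\<close> reduces.\<close>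
  have base: "b = \<zero>\<^bsub>A\<^esub>"
    if b: "b \<in> carrier A" and t: "t \<in> carrier R" "\<iota> b = z \<otimes>\<^bsub>R\<^esub> t" and ba0: "b \<otimes>\<^bsub>A\<^esub> a0 = \<zero>\<^bsub>A\<^esub>" for b t
  proof -
    have zb: "z \<otimes>\<^bsub>R\<^esub> \<iota> b = x \<otimes>\<^bsub>R\<^esub> r \<otimes>\<^bsub>R\<^esub> \<iota> b"
    proof -
      have "\<iota> a0 \<otimes>\<^bsub>R\<^esub> \<iota> b = \<zero>\<^bsub>R\<^esub>"
        using a0_central[OF b] ba0 a0 b by (metis \<iota>.hom_mult \<iota>.hom_zero)
      moreover have "z \<otimes>\<^bsub>R\<^esub> \<iota> b = (\<iota> a0 \<oplus>\<^bsub>R\<^esub> x \<otimes>\<^bsub>R\<^esub> r) \<otimes>\<^bsub>R\<^esub> \<iota> b" using r(2) by (simp add: a0_def)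
      ultimately show ?thesis using a0 b r(1) by (simp add: R.l_distr)
    qed
    have zpow: "z [^]\<^bsub>R\<^esub> k \<otimes>\<^bsub>R\<^esub> \<iota> b = (x \<otimes>\<^bsub>R\<^esub> r) [^]\<^bsub>R\<^esub> k \<otimes>\<^bsub>R\<^esub> \<iota> b" for k :: nat
    proof (induction k)
      case 0 then show ?case by simp
    next
      case (Suc k)
      have "z [^]\<^bsub>R\<^esub> Suc k \<otimes>\<^bsub>R\<^esub> \<iota> b = z \<otimes>\<^bsub>R\<^esub> (z [^]\<^bsub>R\<^esub> k \<otimes>\<^bsub>R\<^esub> \<iota> b)"
        using z b by (simp add: R.m_assoc[symmetric] central)
      also have "\<dots> = (x \<otimes>\<^bsub>R\<^esub> r) [^]\<^bsub>R\<^esub> k \<otimes>\<^bsub>R\<^esub> (z \<otimes>\<^bsub>R\<^esub> \<iota> b)"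
      proof -
        have "z \<otimes>\<^bsub>R\<^esub> (x \<otimes>\<^bsub>R\<^esub> r) [^]\<^bsub>R\<^esub> k = (x \<otimes>\<^bsub>R\<^esub> r) [^]\<^bsub>R\<^esub> k \<otimes>\<^bsub>R\<^esub> z"
          using r(1) by (intro central) simp
        then show ?thesis unfolding Suc using z b r(1) by (simp add: R.m_assoc[symmetric])
      qed
      finally show ?case using zb b r(1) by (simp add: R.m_assoc)
    qed
    define w where "w = r [^]\<^bsub>R\<^esub> (p - 1) \<otimes>\<^bsub>R\<^esub> \<iota> b"
    have w: "w \<in> carrier R" using r(1) b by (simp add: w_def)
    have "z [^]\<^bsub>R\<^esub> (p - 1) \<otimes>\<^bsub>R\<^esub> \<iota> b = z [^]\<^bsub>R\<^esub> Suc (p - 1) \<otimes>\<^bsub>R\<^esub> t"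
      using z t b by (simp add: R.m_assoc)
    also have "\<dots> = \<zero>\<^bsub>R\<^esub>" using p_pos z_pow t by simp
    finally have "x [^]\<^bsub>R\<^esub> (p - 1) \<otimes>\<^bsub>R\<^esub> w = \<zero>\<^bsub>R\<^esub>"
      using zpow[of "p - 1"] b r(1) by (simp add: x_mult_pow w_def R.m_assoc)
    moreover obtain w' where w': "w' \<in> carrier R" "w = \<iota> (\<eta> w) \<oplus>\<^bsub>R\<^esub> x \<otimes>\<^bsub>R\<^esub> w'"
      using decompose[OF w] .
    moreover have "x [^]\<^bsub>R\<^esub> (p - 1) \<otimes>\<^bsub>R\<^esub> (x \<otimes>\<^bsub>R\<^esub> w') = \<zero>\<^bsub>R\<^esub>"
    proof -
      have "x [^]\<^bsub>R\<^esub> (p - 1) \<otimes>\<^bsub>R\<^esub> (x \<otimes>\<^bsub>R\<^esub> w') = x [^]\<^bsub>R\<^esub> Suc (p - 1) \<otimes>\<^bsub>R\<^esub> w'"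
        using w' by (simp add: R.m_assoc)
      then show ?thesis using p_pos x_pow w' by simp
    qed
    ultimately have "x [^]\<^bsub>R\<^esub> (p - 1) \<otimes>\<^bsub>R\<^esub> \<iota> (\<eta> w) = \<zero>\<^bsub>R\<^esub>"
      using w by (metis R.r_distr R.r_zero R.m_closed R.nat_pow_closed x_closed \<eta>.hom_closed \<iota>.hom_closed)
    then have "\<eta> w = \<zero>\<^bsub>A\<^esub>" using top w by simp
    then have "\<eta> r [^]\<^bsub>A\<^esub> (p - 1) \<otimes>\<^bsub>A\<^esub> b = \<zero>\<^bsub>A\<^esub>"
      using r(1) b by (simp add: w_def retraction \<eta>_pow)
    moreover have "\<eta> r [^]\<^bsub>A\<^esub> (p - 1) \<in> Units A" using unit by (rule A.Units_pow_closed)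
    ultimately show ?thesis
      using b A.Units_l_cancel[of "\<eta> r [^]\<^bsub>A\<^esub> (p - 1)" b "\<zero>\<^bsub>A\<^esub>"] by (simp add: A.Units_closed)
  qed
  have "b = \<zero>\<^bsub>A\<^esub>"
    if "b \<in> carrier A" "t \<in> carrier R" "\<iota> b = z \<otimes>\<^bsub>R\<^esub> t" "b \<otimes>\<^bsub>A\<^esub> a0 [^]\<^bsub>A\<^esub> n = \<zero>\<^bsub>A\<^esub>"
    for b t and n :: nat
    using that
  proof (induction n arbitrary: b t)
    case 0 then show ?case by simp
  next
    case (Suc n)
    have "b \<otimes>\<^bsub>A\<^esub> a0 = \<zero>\<^bsub>A\<^esub>"
    proof (rule Suc.IH)
      show "\<iota> (b \<otimes>\<^bsub>A\<^esub> a0) = z \<otimes>\<^bsub>R\<^esub> (t \<otimes>\<^bsub>R\<^esub> \<iota> a0)"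
        using Suc.prems a0 z by (simp add: R.m_assoc)
      show "b \<otimes>\<^bsub>A\<^esub> a0 \<otimes>\<^bsub>A\<^esub> a0 [^]\<^bsub>A\<^esub> n = \<zero>\<^bsub>A\<^esub>"
        using Suc.prems a0 A.nat_pow_Suc2[OF a0, of n] by (simp add: A.m_assoc)
    qed (use Suc.prems a0 in auto)
    then show ?case using base Suc.prems by blast
  qed
  from this[OF a s, of p] show ?thesis using a0_pow a by simp
qed

text \<open>
  The set \<open>M\<close> of elements that are constant modulo \<open>z\<close> is a subring. It contains
  \<open>x t = (\<eta> r)\<^sup>-\<^sup>1 (z - \<eta> z)\<close>, where \<open>\<eta> t = 1\<close>. Since \<open>(x t)\<^sup>k\<close> equals \<open>x\<^sup>k\<close> up to higher powers of \<open>x\<close>, descending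
  induction starting from \<open>x\<^sup>p = 0\<close> puts every \<open>x\<^sup>k R\<close>, and finally \<open>R\<close> itself, inside \<open>M\<close>.
\<close>

lemma embedding_spans:
  assumes z: "z \<in> carrier R" and central: "\<And>r. r \<in> carrier R \<Longrightarrow> z \<otimes>\<^bsub>R\<^esub> r = r \<otimes>\<^bsub>R\<^esub> z"
    and r: "r \<in> carrier R" "z = \<iota> (\<eta> z) \<oplus>\<^bsub>R\<^esub> x \<otimes>\<^bsub>R\<^esub> r" and unit: "\<eta> r \<in> Units A"
    and w: "w \<in> carrier R"
  shows "\<exists>a\<in>carrier A. \<exists>s\<in>carrier R. w = \<iota> a \<oplus>\<^bsub>R\<^esub> z \<otimes>\<^bsub>R\<^esub> s"
proof -
  define M where "M = {m. \<exists>a\<in>carrier A. \<exists>s\<in>carrier R. m = \<iota> a \<oplus>\<^bsub>R\<^esub> z \<otimes>\<^bsub>R\<^esub> s}"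
  have MI: "\<iota> a \<oplus>\<^bsub>R\<^esub> z \<otimes>\<^bsub>R\<^esub> s \<in> M" if "a \<in> carrier A" "s \<in> carrier R" for a s
    using that by (auto simp: M_def)
  have M_add: "m \<oplus>\<^bsub>R\<^esub> n \<in> M" if mn: "m \<in> M" "n \<in> M" for m n
  proof -
    obtain a s b t where 1: "a \<in> carrier A" "s \<in> carrier R" "m = \<iota> a \<oplus>\<^bsub>R\<^esub> z \<otimes>\<^bsub>R\<^esub> s"
      "b \<in> carrier A" "t \<in> carrier R" "n = \<iota> b \<oplus>\<^bsub>R\<^esub> z \<otimes>\<^bsub>R\<^esub> t" using mn by (auto simp: M_def)
    then have "m \<oplus>\<^bsub>R\<^esub> n = \<iota> (a \<oplus>\<^bsub>A\<^esub> b) \<oplus>\<^bsub>R\<^esub> z \<otimes>\<^bsub>R\<^esub> (s \<oplus>\<^bsub>R\<^esub> t)"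
      using z by (simp add: R.r_distr R.a_ac)
    then show ?thesis using MI[of "a \<oplus>\<^bsub>A\<^esub> b" "s \<oplus>\<^bsub>R\<^esub> t"] 1(1,2,4,5) by simp
  qed
  have M_mult: "m \<otimes>\<^bsub>R\<^esub> n \<in> M" if mn: "m \<in> M" "n \<in> M" for m n
  proof -
    obtain a s b t where 1: "a \<in> carrier A" "s \<in> carrier R" "m = \<iota> a \<oplus>\<^bsub>R\<^esub> z \<otimes>\<^bsub>R\<^esub> s"
      "b \<in> carrier A" "t \<in> carrier R" "n = \<iota> b \<oplus>\<^bsub>R\<^esub> z \<otimes>\<^bsub>R\<^esub> t" using mn by (auto simp: M_def)
    have c: "\<iota> a \<otimes>\<^bsub>R\<^esub> (z \<otimes>\<^bsub>R\<^esub> t) = z \<otimes>\<^bsub>R\<^esub> (\<iota> a \<otimes>\<^bsub>R\<^esub> t)"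
      using 1 z central[of "\<iota> a"] by (metis R.m_assoc \<iota>.hom_closed)
    have "m \<otimes>\<^bsub>R\<^esub> n = \<iota> (a \<otimes>\<^bsub>A\<^esub> b) \<oplus>\<^bsub>R\<^esub> z \<otimes>\<^bsub>R\<^esub> (\<iota> a \<otimes>\<^bsub>R\<^esub> t \<oplus>\<^bsub>R\<^esub> s \<otimes>\<^bsub>R\<^esub> n)"
      using 1 z c by (simp add: R.l_distr R.r_distr R.a_ac R.m_assoc)
    moreover have "n \<in> carrier R" using 1 z by simp
    ultimately show ?thesis
      using MI[of "a \<otimes>\<^bsub>A\<^esub> b" "\<iota> a \<otimes>\<^bsub>R\<^esub> t \<oplus>\<^bsub>R\<^esub> s \<otimes>\<^bsub>R\<^esub> n"] 1(1,2,4,5) by simp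
  qed
  have M_\<iota>: "\<iota> a \<in> M" if "a \<in> carrier A" for a
    using MI[OF that, of "\<zero>\<^bsub>R\<^esub>"] z that by simp
  define v where "v = inv\<^bsub>A\<^esub> (\<eta> r)"
  have v: "v \<in> carrier A" "v \<otimes>\<^bsub>A\<^esub> \<eta> r = \<one>\<^bsub>A\<^esub>" using unit by (auto simp: v_def)
  define t where "t = \<iota> v \<otimes>\<^bsub>R\<^esub> r"
  have t: "t \<in> carrier R" "\<eta> t = \<one>\<^bsub>A\<^esub>" using v r(1) by (auto simp: t_def retraction)
  have xt: "x \<otimes>\<^bsub>R\<^esub> t \<in> M"
  proof -
    have xr: "x \<otimes>\<^bsub>R\<^esub> r = \<iota> (\<ominus>\<^bsub>A\<^esub> \<eta> z) \<oplus>\<^bsub>R\<^esub> z \<otimes>\<^bsub>R\<^esub> \<one>\<^bsub>R\<^esub>"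
      using z r(1) by (subst (2) r(2)) (simp add: R.a_assoc[symmetric] R.l_neg)
    have "x \<otimes>\<^bsub>R\<^esub> t = \<iota> v \<otimes>\<^bsub>R\<^esub> (x \<otimes>\<^bsub>R\<^esub> r)"
      using v r(1) x_central[of "\<iota> v"] by (simp add: t_def R.m_assoc[symmetric])
    then show ?thesis unfolding xr using v z by (simp only:) (intro M_mult M_\<iota> MI; simp)
  qed
  have xtk: "(x \<otimes>\<^bsub>R\<^esub> t) [^]\<^bsub>R\<^esub> k \<in> M" for k :: nat
  proof (induction k)
    case 0
    then show ?case using M_\<iota>[of "\<one>\<^bsub>A\<^esub>"] by simp
  next
    case (Suc k) then show ?case using M_mult xt by simp
  qed
  have claim: "\<forall>u\<in>carrier R. x [^]\<^bsub>R\<^esub> (p - j) \<otimes>\<^bsub>R\<^esub> u \<in> M" if "j \<le> p" for j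
    using that
  proof (induction j)
    case 0
    then show ?case using x_pow M_\<iota>[of "\<zero>\<^bsub>A\<^esub>"] by simp
  next
    case (Suc j)
    define k where "k = p - Suc j"
    have k: "p - j = Suc k" using Suc.prems by (simp add: k_def)
    show ?case
    proof
      fix u assume u: "u \<in> carrier R"
      \<comment> \<open>Modulo \<open>x\<close>, \<open>u\<close> is the constant \<open>\<eta> u\<close> and \<open>t\<close> is 1, so \<open>q\<close> is a multiple of \<open>x\<close> and contributes \<open>x [^] (k + 1)\<close>.\<close>
      define q where "q = u \<ominus>\<^bsub>R\<^esub> t [^]\<^bsub>R\<^esub> k \<otimes>\<^bsub>R\<^esub> \<iota> (\<eta> u)"
      have q: "q \<in> carrier R" using u t by (simp add: q_def)
      have "\<eta> q = \<zero>\<^bsub>A\<^esub>"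
        using u t by (simp add: q_def R.minus_eq retraction \<eta>_pow A.r_neg)
      then obtain s where s: "s \<in> carrier R" "q = x \<otimes>\<^bsub>R\<^esub> s" using \<eta>_kernel q by blast
      have "u = t [^]\<^bsub>R\<^esub> k \<otimes>\<^bsub>R\<^esub> \<iota> (\<eta> u) \<oplus>\<^bsub>R\<^esub> q"
      proof -
        have "a \<in> carrier R \<Longrightarrow> b \<in> carrier R \<Longrightarrow> a = b \<oplus>\<^bsub>R\<^esub> (a \<ominus>\<^bsub>R\<^esub> b)" for a b by algebra
        then show ?thesis unfolding q_def using u t by simp
      qed
      then have "x [^]\<^bsub>R\<^esub> k \<otimes>\<^bsub>R\<^esub> u
          = (x \<otimes>\<^bsub>R\<^esub> t) [^]\<^bsub>R\<^esub> k \<otimes>\<^bsub>R\<^esub> \<iota> (\<eta> u) \<oplus>\<^bsub>R\<^esub> x [^]\<^bsub>R\<^esub> (p - j) \<otimes>\<^bsub>R\<^esub> s"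
        unfolding k using u t s q
        by (metis R.m_assoc R.r_distr R.m_closed R.nat_pow_closed R.nat_pow_Suc x_closed x_mult_pow
            \<eta>.hom_closed \<iota>.hom_closed)
      then show "x [^]\<^bsub>R\<^esub> (p - Suc j) \<otimes>\<^bsub>R\<^esub> u \<in> M"
        using Suc s u xtk M_add M_mult M_\<iota> by (simp add: k_def)
    qed
  qed
  from claim[of p] w have "w \<in> M" by simp
  then show ?thesis by (simp add: M_def)
qed

lemma complementary_embedding:
  assumes "z \<in> carrier R" and "\<And>r. r \<in> carrier R \<Longrightarrow> z \<otimes>\<^bsub>R\<^esub> r = r \<otimes>\<^bsub>R\<^esub> z"
    and "z [^]\<^bsub>R\<^esub> p = \<zero>\<^bsub>R\<^esub>"
    and "r \<in> carrier R" "z = \<iota> (\<eta> z) \<oplus>\<^bsub>R\<^esub> x \<otimes>\<^bsub>R\<^esub> r" "\<eta> r \<in> Units A"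
  shows "complementary_embedding A R \<iota> z"
  unfolding complementary_embedding_def
  using embedding_spans[OF assms(1,2,4-6)] embedding_meets_trivially[OF assms] by blast

end

lemma complementary_embedding_transport:
  assumes "complementary_embedding A R \<iota> z" and \<theta>: "\<theta> \<in> ring_iso R S"
    and "z \<in> carrier R" and \<iota>: "\<iota> \<in> carrier A \<rightarrow> carrier R" and "ring R" "ring S"
  shows "complementary_embedding A S (\<theta> \<circ> \<iota>) (\<theta> z)"
proof -
  interpret R: ring R by fact
  interpret S: ring S by fact
  have hom: "\<theta> \<in> ring_hom R S" and bij: "bij_betw \<theta> (carrier R) (carrier S)"
    using \<theta> by (auto simp: ring_iso_def)
  have surj: "\<exists>s\<in>carrier R. t = \<theta> s" if "t \<in> carrier S" for t
    using bij that by (auto simp: bij_betw_def)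
  have inj: "r = s" if "r \<in> carrier R" "s \<in> carrier R" "\<theta> r = \<theta> s" for r s
    using bij that by (auto simp: bij_betw_def inj_on_def)
  note hom_simps = ring_hom_add[OF hom] ring_hom_mult[OF hom]
  show ?thesis
    unfolding complementary_embedding_def
  proof (intro conjI ballI impI)
    fix t assume "t \<in> carrier S"
    then obtain r where r: "r \<in> carrier R" "t = \<theta> r" using surj by blast
    then obtain a s where as: "a \<in> carrier A" "s \<in> carrier R" "r = \<iota> a \<oplus>\<^bsub>R\<^esub> z \<otimes>\<^bsub>R\<^esub> s"
      using assms(1) by (auto simp: complementary_embedding_def)
    moreover have "\<iota> a \<in> carrier R" using \<iota> as by auto
    ultimately have "t = (\<theta> \<circ> \<iota>) a \<oplus>\<^bsub>S\<^esub> \<theta> z \<otimes>\<^bsub>S\<^esub> \<theta> s"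
      using r assms(3) by (simp add: hom_simps)
    then show "\<exists>a\<in>carrier A. \<exists>s\<in>carrier S. t = (\<theta> \<circ> \<iota>) a \<oplus>\<^bsub>S\<^esub> \<theta> z \<otimes>\<^bsub>S\<^esub> s"
      using as ring_hom_closed[OF hom] by blast
  next
    fix a t assume a: "a \<in> carrier A" and t: "t \<in> carrier S" "(\<theta> \<circ> \<iota>) a = \<theta> z \<otimes>\<^bsub>S\<^esub> t"
    obtain s where s: "s \<in> carrier R" "t = \<theta> s" using surj t by blast
    have "\<iota> a = z \<otimes>\<^bsub>R\<^esub> s"
      using a t s assms(3) \<iota> by (intro inj) (auto simp: hom_simps)
    then show "a = \<zero>\<^bsub>A\<^esub>" using assms(1) a s by (auto simp: complementary_embedding_def)
  qed
qed

text \<open>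
  Both \<open>A\<close> and \<open>B\<close> are identified with \<open>R/zR\<close>; the isomorphism sends \<open>a\<close> to the unique \<open>b\<close>
  whose image in \<open>R\<close> is congruent to that of \<open>a\<close> modulo \<open>z\<close>.
\<close>

lemma complementary_embeddings_imp_isomorphic:
  assumes A: "unital_algebra F A" and B: "unital_algebra F B" and R: "unital_algebra F R"
    and \<iota>: "\<iota> \<in> algebra_hom F A R" and \<kappa>: "\<kappa> \<in> algebra_hom F B R"
    and z: "z \<in> carrier R" and central: "\<And>r. r \<in> carrier R \<Longrightarrow> z \<otimes>\<^bsub>R\<^esub> r = r \<otimes>\<^bsub>R\<^esub> z"
    and cA: "complementary_embedding A R \<iota> z" and cB: "complementary_embedding B R \<kappa> z"
  shows "algebra_isomorphic F A B"
proof -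
  interpret A: unital_algebra F A by fact
  interpret B: unital_algebra F B by fact
  interpret R: unital_algebra F R by fact
  interpret \<iota>: ring_hom_ring A R \<iota>
    using \<iota> by (auto intro: ring_hom_ringI2 A.ring_axioms R.ring_axioms simp: algebra_hom_def)
  interpret \<kappa>: ring_hom_ring B R \<kappa>
    using \<kappa> by (auto intro: ring_hom_ringI2 B.ring_axioms R.ring_axioms simp: algebra_hom_def)
  have \<iota>_smult: "\<iota> (c \<odot>\<^bsub>A\<^esub> a) = c \<odot>\<^bsub>R\<^esub> \<iota> a" if "c \<in> carrier F" "a \<in> carrier A" for c a
    using \<iota> that by (simp add: algebra_hom_def)
  have \<kappa>_smult: "\<kappa> (c \<odot>\<^bsub>B\<^esub> b) = c \<odot>\<^bsub>R\<^esub> \<kappa> b" if "c \<in> carrier F" "b \<in> carrier B" for c b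
    using \<kappa> that by (simp add: algebra_hom_def)
  define rel where "rel a b \<longleftrightarrow> (\<exists>s\<in>carrier R. \<iota> a = \<kappa> b \<oplus>\<^bsub>R\<^esub> z \<otimes>\<^bsub>R\<^esub> s)" for a b
  have rel_total: "\<exists>b\<in>carrier B. rel a b" if "a \<in> carrier A" for a
    using cB \<iota>.hom_closed[OF that] by (auto simp: complementary_embedding_def rel_def)
  have rel_surj: "\<exists>a\<in>carrier A. rel a b" if b: "b \<in> carrier B" for b
  proof -
    obtain a s where a: "a \<in> carrier A" "s \<in> carrier R" "\<kappa> b = \<iota> a \<oplus>\<^bsub>R\<^esub> z \<otimes>\<^bsub>R\<^esub> s"
      using cA \<kappa>.hom_closed[OF b] by (auto simp: complementary_embedding_def)
    have "\<iota> a = \<kappa> b \<oplus>\<^bsub>R\<^esub> z \<otimes>\<^bsub>R\<^esub> (\<ominus>\<^bsub>R\<^esub> s)"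
      unfolding a(3) using a z by (simp add: R.r_minus R.a_assoc R.r_neg)
    then show ?thesis using a by (auto simp: rel_def)
  qed
  have rel_unique: "b = b'" if "a \<in> carrier A" "b \<in> carrier B" "b' \<in> carrier B" and rel: "rel a b" "rel a b'" for a b b'
  proof -
    obtain s t where st: "s \<in> carrier R" "\<iota> a = \<kappa> b \<oplus>\<^bsub>R\<^esub> z \<otimes>\<^bsub>R\<^esub> s" "t \<in> carrier R" "\<iota> a = \<kappa> b' \<oplus>\<^bsub>R\<^esub> z \<otimes>\<^bsub>R\<^esub> t"
      using rel by (auto simp: rel_def)
    have "\<kappa> (b \<ominus>\<^bsub>B\<^esub> b') = z \<otimes>\<^bsub>R\<^esub> (t \<ominus>\<^bsub>R\<^esub> s)"
    proof -
      have "u \<ominus>\<^bsub>R\<^esub> v = y \<ominus>\<^bsub>R\<^esub> w" if "u \<in> carrier R" "v \<in> carrier R" "w \<in> carrier R" "y \<in> carrier R" "u \<oplus>\<^bsub>R\<^esub> w = v \<oplus>\<^bsub>R\<^esub> y"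
        for u v w y
      proof -
        have "u \<ominus>\<^bsub>R\<^esub> v = (u \<oplus>\<^bsub>R\<^esub> w) \<ominus>\<^bsub>R\<^esub> w \<ominus>\<^bsub>R\<^esub> v" using that(1-4) by algebra
        also have "\<dots> = y \<ominus>\<^bsub>R\<^esub> w" unfolding that(5) using that(1-4) by algebra
        finally show ?thesis .
      qed
      from this[of "\<kappa> b" "\<kappa> b'" "z \<otimes>\<^bsub>R\<^esub> s" "z \<otimes>\<^bsub>R\<^esub> t"] st that(2,3) z
      show ?thesis by (simp add: R.minus_eq B.minus_eq R.r_distr R.r_minus)
    qed
    moreover have "b \<ominus>\<^bsub>B\<^esub> b' \<in> carrier B" "t \<ominus>\<^bsub>R\<^esub> s \<in> carrier R" using that st by auto
    ultimately have "b \<ominus>\<^bsub>B\<^esub> b' = \<zero>\<^bsub>B\<^esub>" using cB unfolding complementary_embedding_def by blast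
    then show ?thesis using that by simp
  qed
  have rel_inj: "a = a'" if "a \<in> carrier A" "a' \<in> carrier A" "b \<in> carrier B" and rel: "rel a b" "rel a' b" for a a' b
  proof -
    obtain s t where st: "s \<in> carrier R" "\<iota> a = \<kappa> b \<oplus>\<^bsub>R\<^esub> z \<otimes>\<^bsub>R\<^esub> s" "t \<in> carrier R" "\<iota> a' = \<kappa> b \<oplus>\<^bsub>R\<^esub> z \<otimes>\<^bsub>R\<^esub> t"
      using rel by (auto simp: rel_def)
    have "\<iota> (a \<ominus>\<^bsub>A\<^esub> a') = z \<otimes>\<^bsub>R\<^esub> (s \<ominus>\<^bsub>R\<^esub> t)"
    proof -
      have "(u \<oplus>\<^bsub>R\<^esub> v) \<ominus>\<^bsub>R\<^esub> (u \<oplus>\<^bsub>R\<^esub> w) = v \<ominus>\<^bsub>R\<^esub> w" if "u \<in> carrier R" "v \<in> carrier R" "w \<in> carrier R" for u v w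
        using that by algebra
      then show ?thesis using st that(1-3) z by (simp add: R.minus_eq A.minus_eq R.r_distr R.r_minus)
    qed
    moreover have "a \<ominus>\<^bsub>A\<^esub> a' \<in> carrier A" "s \<ominus>\<^bsub>R\<^esub> t \<in> carrier R" using that st by auto
    ultimately have "a \<ominus>\<^bsub>A\<^esub> a' = \<zero>\<^bsub>A\<^esub>" using cA unfolding complementary_embedding_def by blast
    then show ?thesis using that by simp
  qed
  define \<phi> where "\<phi> a = (SOME b. b \<in> carrier B \<and> rel a b)" for a
  have \<phi>: "\<phi> a \<in> carrier B \<and> rel a (\<phi> a)" if "a \<in> carrier A" for a
    unfolding \<phi>_def by (rule someI_ex) (use rel_total[OF that] in blast)
  have \<phi>_eq: "\<phi> a = b" if "a \<in> carrier A" "b \<in> carrier B" "rel a b" for a b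
    using rel_unique \<phi> that by blast
  have "\<phi> \<in> ring_hom A B"
  proof (rule ring_hom_memI)
    show "\<phi> \<one>\<^bsub>A\<^esub> = \<one>\<^bsub>B\<^esub>"
      using z by (intro \<phi>_eq) (auto simp: rel_def intro!: bexI[of _ "\<zero>\<^bsub>R\<^esub>"])
    fix a a' assume a: "a \<in> carrier A" "a' \<in> carrier A"
    obtain s t where st: "s \<in> carrier R" "\<iota> a = \<kappa> (\<phi> a) \<oplus>\<^bsub>R\<^esub> z \<otimes>\<^bsub>R\<^esub> s"
      "t \<in> carrier R" "\<iota> a' = \<kappa> (\<phi> a') \<oplus>\<^bsub>R\<^esub> z \<otimes>\<^bsub>R\<^esub> t"
      using \<phi>[OF a(1)] \<phi>[OF a(2)] by (auto simp: rel_def)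
    have c: "\<phi> a \<in> carrier B" "\<phi> a' \<in> carrier B" using \<phi> a by auto
    show "\<phi> (a \<oplus>\<^bsub>A\<^esub> a') = \<phi> a \<oplus>\<^bsub>B\<^esub> \<phi> a'"
    proof (rule \<phi>_eq)
      have "\<iota> (a \<oplus>\<^bsub>A\<^esub> a') = \<kappa> (\<phi> a \<oplus>\<^bsub>B\<^esub> \<phi> a') \<oplus>\<^bsub>R\<^esub> z \<otimes>\<^bsub>R\<^esub> (s \<oplus>\<^bsub>R\<^esub> t)"
        using a c st z by (simp add: R.r_distr R.a_ac)
      then show "rel (a \<oplus>\<^bsub>A\<^esub> a') (\<phi> a \<oplus>\<^bsub>B\<^esub> \<phi> a')" using st by (auto simp: rel_def)
    qed (use a c in auto)
    show "\<phi> (a \<otimes>\<^bsub>A\<^esub> a') = \<phi> a \<otimes>\<^bsub>B\<^esub> \<phi> a'"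
    proof (rule \<phi>_eq)
      have k: "\<kappa> (\<phi> a) \<in> carrier R" "\<kappa> (\<phi> a') \<in> carrier R" "\<iota> a' \<in> carrier R" using a c by auto
      have "\<iota> (a \<otimes>\<^bsub>A\<^esub> a') = (\<kappa> (\<phi> a) \<oplus>\<^bsub>R\<^esub> z \<otimes>\<^bsub>R\<^esub> s) \<otimes>\<^bsub>R\<^esub> \<iota> a'"
        using a st(2) by simp
      also have "\<dots> = \<kappa> (\<phi> a) \<otimes>\<^bsub>R\<^esub> \<iota> a' \<oplus>\<^bsub>R\<^esub> z \<otimes>\<^bsub>R\<^esub> (s \<otimes>\<^bsub>R\<^esub> \<iota> a')"
        using k st(1) z by (simp only: R.l_distr R.m_assoc R.m_closed)
      also have "\<kappa> (\<phi> a) \<otimes>\<^bsub>R\<^esub> \<iota> a' = \<kappa> (\<phi> a \<otimes>\<^bsub>B\<^esub> \<phi> a') \<oplus>\<^bsub>R\<^esub> \<kappa> (\<phi> a) \<otimes>\<^bsub>R\<^esub> (z \<otimes>\<^bsub>R\<^esub> t)"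
        unfolding st(4) using k st(3) z c by (simp add: R.r_distr)
      also have "\<kappa> (\<phi> a) \<otimes>\<^bsub>R\<^esub> (z \<otimes>\<^bsub>R\<^esub> t) = z \<otimes>\<^bsub>R\<^esub> (\<kappa> (\<phi> a) \<otimes>\<^bsub>R\<^esub> t)"
        using k z st(3) central[of "\<kappa> (\<phi> a)"] by (metis R.m_assoc)
      finally have "\<iota> (a \<otimes>\<^bsub>A\<^esub> a') = \<kappa> (\<phi> a \<otimes>\<^bsub>B\<^esub> \<phi> a') \<oplus>\<^bsub>R\<^esub> z \<otimes>\<^bsub>R\<^esub> (\<kappa> (\<phi> a) \<otimes>\<^bsub>R\<^esub> t \<oplus>\<^bsub>R\<^esub> s \<otimes>\<^bsub>R\<^esub> \<iota> a')"
        using k st(1,3) z c by (simp add: R.r_distr R.a_assoc del: \<kappa>.hom_mult)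
      moreover have "\<kappa> (\<phi> a) \<otimes>\<^bsub>R\<^esub> t \<oplus>\<^bsub>R\<^esub> s \<otimes>\<^bsub>R\<^esub> \<iota> a' \<in> carrier R" using k st(1,3) by (intro R.add.m_closed R.m_closed)
      ultimately show "rel (a \<otimes>\<^bsub>A\<^esub> a') (\<phi> a \<otimes>\<^bsub>B\<^esub> \<phi> a')" unfolding rel_def by blast
    qed (use a c in auto)
  qed (use \<phi> in auto)
  moreover have "bij_betw \<phi> (carrier A) (carrier B)"
  proof (rule bij_betwI')
    show "\<phi> a = \<phi> a' \<longleftrightarrow> a = a'" if "a \<in> carrier A" "a' \<in> carrier A" for a a'
      using rel_inj[OF that, of "\<phi> a"] \<phi>[OF that(1)] \<phi>[OF that(2)] by auto
    show "\<phi> a \<in> carrier B" if "a \<in> carrier A" for a using \<phi>[OF that] by simp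
    show "\<exists>a\<in>carrier A. b = \<phi> a" if "b \<in> carrier B" for b
      using rel_surj[OF that] \<phi>_eq that by metis
  qed
  moreover have "\<phi> (c \<odot>\<^bsub>A\<^esub> a) = c \<odot>\<^bsub>B\<^esub> \<phi> a" if c: "c \<in> carrier F" and a: "a \<in> carrier A" for c a
  proof (rule \<phi>_eq)
    obtain s where s: "s \<in> carrier R" "\<iota> a = \<kappa> (\<phi> a) \<oplus>\<^bsub>R\<^esub> z \<otimes>\<^bsub>R\<^esub> s" using \<phi> a by (auto simp: rel_def)
    have "\<iota> (c \<odot>\<^bsub>A\<^esub> a) = \<kappa> (c \<odot>\<^bsub>B\<^esub> \<phi> a) \<oplus>\<^bsub>R\<^esub> z \<otimes>\<^bsub>R\<^esub> (c \<odot>\<^bsub>R\<^esub> s)"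
      using a c s z \<phi>[OF a] by (simp add: \<iota>_smult \<kappa>_smult R.smult_r_distr R.smult_mult_right)
    then show "rel (c \<odot>\<^bsub>A\<^esub> a) (c \<odot>\<^bsub>B\<^esub> \<phi> a)" using c s by (auto simp: rel_def)
  qed (use a c \<phi> in auto)
  ultimately have "\<phi> \<in> algebra_iso F A B" by (auto simp: algebra_iso_def ring_iso_def)
  then show ?thesis by (auto simp: algebra_isomorphic_def)
qed

context truncated_extension
begin

text \<open>
  The image \<open>\<eta> r\<close> is the coefficient of \<open>x\<close> in the expansion of \<open>z\<close> in powers of \<open>x\<close>.
\<close>

definition linear_unit where
  "linear_unit z \<longleftrightarrow> (\<exists>r\<in>carrier R. z = \<iota> (\<eta> z) \<oplus>\<^bsub>R\<^esub> x \<otimes>\<^bsub>R\<^esub> r \<and> \<eta> r \<in> Units A)"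

lemma linear_unit_x: "linear_unit x"
  unfolding linear_unit_def by (rule bexI[of _ "\<one>\<^bsub>R\<^esub>"]) (simp_all add: \<eta>_x)

text \<open>
  Adding \<open>x\<close> raises the linear coefficient by 1, which turns a non-unit into a unit because \<open>A\<close> is
  local.
\<close>

lemma linear_unit_add_x:
  assumes local_A: "\<And>a. \<lbrakk>a \<in> carrier A; a \<notin> Units A\<rbrakk> \<Longrightarrow> \<one>\<^bsub>A\<^esub> \<oplus>\<^bsub>A\<^esub> a \<in> Units A"
    and z: "z \<in> carrier R" "\<not> linear_unit z"
  shows "linear_unit (x \<oplus>\<^bsub>R\<^esub> z)"
proof -
  obtain r where r: "r \<in> carrier R" "z = \<iota> (\<eta> z) \<oplus>\<^bsub>R\<^esub> x \<otimes>\<^bsub>R\<^esub> r" using decompose[OF z(1)] .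
  have "\<eta> r \<notin> Units A" using z(2) r by (auto simp: linear_unit_def)
  then have "\<one>\<^bsub>A\<^esub> \<oplus>\<^bsub>A\<^esub> \<eta> r \<in> Units A" using local_A r(1) by simp
  moreover have "x \<oplus>\<^bsub>R\<^esub> z = \<iota> (\<eta> (x \<oplus>\<^bsub>R\<^esub> z)) \<oplus>\<^bsub>R\<^esub> x \<otimes>\<^bsub>R\<^esub> (\<one>\<^bsub>R\<^esub> \<oplus>\<^bsub>R\<^esub> r)"
  proof -
    have "x \<oplus>\<^bsub>R\<^esub> (u \<oplus>\<^bsub>R\<^esub> x \<otimes>\<^bsub>R\<^esub> r) = u \<oplus>\<^bsub>R\<^esub> x \<otimes>\<^bsub>R\<^esub> (\<one>\<^bsub>R\<^esub> \<oplus>\<^bsub>R\<^esub> r)" if "u \<in> carrier R" for u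
      using that r(1) by (simp add: R.r_distr R.a_ac)
    note this[of "\<iota> (\<eta> z)"]
    moreover have "x \<oplus>\<^bsub>R\<^esub> z = x \<oplus>\<^bsub>R\<^esub> (\<iota> (\<eta> z) \<oplus>\<^bsub>R\<^esub> x \<otimes>\<^bsub>R\<^esub> r)"
      by (rule arg_cong[OF r(2)])
    ultimately have "x \<oplus>\<^bsub>R\<^esub> z = \<iota> (\<eta> z) \<oplus>\<^bsub>R\<^esub> x \<otimes>\<^bsub>R\<^esub> (\<one>\<^bsub>R\<^esub> \<oplus>\<^bsub>R\<^esub> r)"
      using z(1) by (simp only: \<eta>.hom_closed \<iota>.hom_closed)
    moreover have "\<eta> (x \<oplus>\<^bsub>R\<^esub> z) = \<eta> z" using z(1) by (simp add: \<eta>_x)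
    ultimately show ?thesis by simp
  qed
  ultimately show ?thesis using r(1) unfolding linear_unit_def
    by (intro bexI[of _ "\<one>\<^bsub>R\<^esub> \<oplus>\<^bsub>R\<^esub> r"]) auto
qed

lemma linear_unit_complementary:
  assumes "z \<in> carrier R" "\<And>r. r \<in> carrier R \<Longrightarrow> z \<otimes>\<^bsub>R\<^esub> r = r \<otimes>\<^bsub>R\<^esub> z" "z [^]\<^bsub>R\<^esub> p = \<zero>\<^bsub>R\<^esub>" "linear_unit z"
  shows "complementary_embedding A R \<iota> z"
  using assms complementary_embedding by (auto simp: linear_unit_def)

end

text \<open>
  The cancellation step: pulling \<open>y\<close> back along the isomorphism, one of \<open>y\<close>, \<open>x\<close> and \<open>x + y\<close> has unit
  linear coefficient in both presentations.
\<close>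

lemma truncated_extension_cancel:
  fixes p :: nat
  assumes p: "Factorial_Ring.prime p" and char: "add_pow R p \<one>\<^bsub>R\<^esub> = \<zero>\<^bsub>R\<^esub>"
    and algA: "unital_algebra F A" and algB: "unital_algebra F B" and algS: "unital_algebra F S"
    and L: "truncated_extension A R \<iota> \<eta> x p" and L': "truncated_extension B S \<kappa> \<zeta> y p"
    and \<iota>: "\<iota> \<in> algebra_hom F A R" and \<kappa>: "\<kappa> \<in> algebra_hom F B S"
    and local_A: "\<And>a. \<lbrakk>a \<in> carrier A; a \<notin> Units A\<rbrakk> \<Longrightarrow> \<one>\<^bsub>A\<^esub> \<oplus>\<^bsub>A\<^esub> a \<in> Units A"
    and local_B: "\<And>b. \<lbrakk>b \<in> carrier B; b \<notin> Units B\<rbrakk> \<Longrightarrow> \<one>\<^bsub>B\<^esub> \<oplus>\<^bsub>B\<^esub> b \<in> Units B"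
    and iso: "algebra_isomorphic F R S"
  shows "algebra_isomorphic F A B"
proof -
  interpret L: truncated_extension A R \<iota> \<eta> x p by fact
  interpret L': truncated_extension B S \<kappa> \<zeta> y p by fact
  obtain \<theta> where \<theta>: "\<theta> \<in> algebra_iso F R S" using iso by (auto simp: algebra_isomorphic_def)
  then have riso: "\<theta> \<in> ring_iso R S" and smult: "\<And>c r. \<lbrakk>c \<in> carrier F; r \<in> carrier R\<rbrakk> \<Longrightarrow> \<theta> (c \<odot>\<^bsub>R\<^esub> r) = c \<odot>\<^bsub>S\<^esub> \<theta> r"
    by (auto simp: algebra_iso_def)
  have hom: "\<theta> \<in> ring_hom R S" and bij: "bij_betw \<theta> (carrier R) (carrier S)"
    using riso by (auto simp: ring_iso_def)
  interpret \<theta>: ring_hom_ring R S \<theta>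
    using hom by (auto intro: ring_hom_ringI2 L.R.ring_axioms L'.R.ring_axioms)
  have inj: "r = s" if "r \<in> carrier R" "s \<in> carrier R" "\<theta> r = \<theta> s" for r s
    using bij that by (auto simp: bij_betw_def inj_on_def)
  obtain y' where y': "y' \<in> carrier R" "\<theta> y' = y"
  proof -
    have "y \<in> \<theta> ` carrier R" using bij by (simp add: bij_betw_def)
    then show thesis using that by blast
  qed
  have \<theta>_pow: "\<theta> (r [^]\<^bsub>R\<^esub> (n::nat)) = \<theta> r [^]\<^bsub>S\<^esub> n" if "r \<in> carrier R" for r n
    using that by (induction n) auto
  have y'_central: "y' \<otimes>\<^bsub>R\<^esub> r = r \<otimes>\<^bsub>R\<^esub> y'" if "r \<in> carrier R" for r
    using y' that L'.x_central[of "\<theta> r"] by (intro inj) auto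
  have y'_pow: "y' [^]\<^bsub>R\<^esub> p = \<zero>\<^bsub>R\<^esub>"
    using y' L'.x_pow by (intro inj) (auto simp: \<theta>_pow)
  have "\<exists>z\<in>carrier R. (\<forall>r\<in>carrier R. z \<otimes>\<^bsub>R\<^esub> r = r \<otimes>\<^bsub>R\<^esub> z) \<and> z [^]\<^bsub>R\<^esub> p = \<zero>\<^bsub>R\<^esub> \<and>
      L.linear_unit z \<and> L'.linear_unit (\<theta> z)"
  proof -
    consider "L.linear_unit y'" | "L'.linear_unit (\<theta> x)" | "\<not> L.linear_unit y'" "\<not> L'.linear_unit (\<theta> x)" by blast
    then show ?thesis
    proof cases
      case 1
      then show ?thesis using y' y'_central y'_pow L'.linear_unit_x by (intro bexI[of _ y']) auto
    next
      case 2
      then show ?thesis using L.x_central L.x_pow L.linear_unit_x by (intro bexI[of _ x]) auto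
    next
      case 3
      have "L.linear_unit (x \<oplus>\<^bsub>R\<^esub> y')" using local_A y'(1) 3(1) by (rule L.linear_unit_add_x)
      moreover have "L'.linear_unit (\<theta> (x \<oplus>\<^bsub>R\<^esub> y'))"
      proof -
        have "L'.linear_unit (y \<oplus>\<^bsub>S\<^esub> \<theta> x)" using 3(2) by (intro L'.linear_unit_add_x local_B) auto
        then show ?thesis using y' by (simp add: L'.R.a_comm)
      qed
      moreover have "(x \<oplus>\<^bsub>R\<^esub> y') [^]\<^bsub>R\<^esub> p = \<zero>\<^bsub>R\<^esub>"
        using L.R.frobenius_commuting[OF p char L.x_closed y'(1) L.x_central[OF y'(1)]] L.x_pow y'_pow by simp
      moreover have "\<forall>r\<in>carrier R. (x \<oplus>\<^bsub>R\<^esub> y') \<otimes>\<^bsub>R\<^esub> r = r \<otimes>\<^bsub>R\<^esub> (x \<oplus>\<^bsub>R\<^esub> y')"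
        using L.x_central y'_central y'(1) by (simp add: L.R.l_distr L.R.r_distr)
      ultimately show ?thesis using y'(1) by (intro bexI[of _ "x \<oplus>\<^bsub>R\<^esub> y'"]) auto
    qed
  qed
  then obtain z where z: "z \<in> carrier R" "\<And>r. r \<in> carrier R \<Longrightarrow> z \<otimes>\<^bsub>R\<^esub> r = r \<otimes>\<^bsub>R\<^esub> z"
    "z [^]\<^bsub>R\<^esub> p = \<zero>\<^bsub>R\<^esub>" "L.linear_unit z" "L'.linear_unit (\<theta> z)" by blast
  have \<theta>z_central: "\<theta> z \<otimes>\<^bsub>S\<^esub> s = s \<otimes>\<^bsub>S\<^esub> \<theta> z" if "s \<in> carrier S" for s
  proof -
    have "s \<in> \<theta> ` carrier R" using bij that by (simp add: bij_betw_def)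
    then obtain r where r: "r \<in> carrier R" "s = \<theta> r" by blast
    show ?thesis
      unfolding r(2) \<theta>.hom_mult[OF z(1) r(1), symmetric] \<theta>.hom_mult[OF r(1) z(1), symmetric]
      using z(2)[OF r(1)] by (rule arg_cong)
  qed
  have cA: "complementary_embedding A S (\<theta> \<circ> \<iota>) (\<theta> z)"
    using L.linear_unit_complementary[OF z(1-4)] riso z(1)
    by (intro complementary_embedding_transport[where R = R]) (auto intro: L.R.ring_axioms L'.R.ring_axioms)
  have cB: "complementary_embedding B S \<kappa> (\<theta> z)"
  proof (rule L'.linear_unit_complementary)
    show "\<theta> z [^]\<^bsub>S\<^esub> p = \<zero>\<^bsub>S\<^esub>" using z(1,3) by (simp add: \<theta>_pow[symmetric])
  qed (use z \<theta>z_central in auto)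
  have "\<theta> \<circ> \<iota> \<in> ring_hom A S"
    using L.\<iota>_hom hom by (rule ring_hom_trans)
  moreover have "(\<theta> \<circ> \<iota>) (c \<odot>\<^bsub>A\<^esub> a) = c \<odot>\<^bsub>S\<^esub> (\<theta> \<circ> \<iota>) a" if "c \<in> carrier F" "a \<in> carrier A" for c a
    using \<iota> that smult[of c "\<iota> a"] by (simp add: algebra_hom_def)
  ultimately have \<theta>\<iota>: "\<theta> \<circ> \<iota> \<in> algebra_hom F A S"
    unfolding algebra_hom_def by blast
  show ?thesis
    by (rule complementary_embeddings_imp_isomorphic[OF algA algB algS \<theta>\<iota> \<kappa> _ \<theta>z_central cA cB])
      (use z(1) in simp_all)
qed

section \<open>Group algebras of finite groups\<close>

definition monomial where
  "monomial F G c g = (\<lambda>x\<in>carrier G. if x = g then c else \<zero>\<^bsub>F\<^esub>)"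

definition augmentation where
  "augmentation F G f = (\<Oplus>\<^bsub>F\<^esub>g\<in>carrier G. f g)"

text \<open>
  The linear map of group algebras induced by a map of the underlying sets of the groups.
\<close>

definition pushforward where
  "pushforward F G Q \<pi> f = (\<lambda>q\<in>carrier Q. \<Oplus>\<^bsub>F\<^esub>g\<in>carrier G. if \<pi> g = q then f g else \<zero>\<^bsub>F\<^esub>)"

lemma finsum_delta:
  assumes "abelian_monoid F" "finite S" "i \<in> S" "c \<in> carrier F"
  shows "(\<Oplus>\<^bsub>F\<^esub>j\<in>S. if j = i then c else \<zero>\<^bsub>F\<^esub>) = c"
proof -
  interpret abelian_monoid F by fact
  show ?thesis
    using finsum_singleton[OF assms(3,2), of "\<lambda>_. c"] assms by (auto simp: eq_commute)
qed

locale finite_group_algebra = F: cring F + G: group G for F (structure) and G (structure) +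
  assumes finite_G [simp, intro]: "finite (carrier G)"
begin

abbreviation FG where "FG \<equiv> group_algebra F G"
abbreviation mon where "mon \<equiv> monomial F G"

lemma carrier_FG: "carrier FG = carrier G \<rightarrow>\<^sub>E carrier F"
  by (simp add: group_algebra_def)

lemma value_closed [simp]: "f \<in> carrier FG \<Longrightarrow> g \<in> carrier G \<Longrightarrow> f g \<in> carrier F"
  by (auto simp: carrier_FG)

lemma FG_eqI:
  assumes "f \<in> carrier FG" "h \<in> carrier FG" "\<And>g. g \<in> carrier G \<Longrightarrow> f g = h g"
  shows "f = h"
  using assms by (auto simp: carrier_FG intro: PiE_ext)

lemma add_apply [simp]: "g \<in> carrier G \<Longrightarrow> (a \<oplus>\<^bsub>FG\<^esub> b) g = a g \<oplus>\<^bsub>F\<^esub> b g"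
  by (simp add: group_algebra_def)

lemma zero_apply [simp]: "g \<in> carrier G \<Longrightarrow> \<zero>\<^bsub>FG\<^esub> g = \<zero>\<^bsub>F\<^esub>"
  by (simp add: group_algebra_def)

lemma one_FG: "\<one>\<^bsub>FG\<^esub> = mon \<one>\<^bsub>F\<^esub> \<one>\<^bsub>G\<^esub>"
  by (simp add: group_algebra_def monomial_def)

lemma smult_apply [simp]: "g \<in> carrier G \<Longrightarrow> (c \<odot>\<^bsub>FG\<^esub> a) g = c \<otimes>\<^bsub>F\<^esub> a g"
  by (simp add: group_algebra_def)

lemma mult_apply: "g \<in> carrier G \<Longrightarrow>
    (a \<otimes>\<^bsub>FG\<^esub> b) g = (\<Oplus>\<^bsub>F\<^esub>y\<in>carrier G. a y \<otimes>\<^bsub>F\<^esub> b (inv\<^bsub>G\<^esub> y \<otimes>\<^bsub>G\<^esub> g))"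
  by (simp add: group_algebra_def)

lemma mon_apply: "x \<in> carrier G \<Longrightarrow> mon c g x = (if x = g then c else \<zero>\<^bsub>F\<^esub>)"
  by (simp add: monomial_def)

lemma mon_closed [simp]: "c \<in> carrier F \<Longrightarrow> mon c g \<in> carrier FG"
  by (auto simp: carrier_FG monomial_def)

lemma zero_closed [simp]: "\<zero>\<^bsub>FG\<^esub> \<in> carrier FG"
  by (auto simp: group_algebra_def)

lemma add_closed [simp]: "a \<in> carrier FG \<Longrightarrow> b \<in> carrier FG \<Longrightarrow> a \<oplus>\<^bsub>FG\<^esub> b \<in> carrier FG"
  by (auto simp: group_algebra_def)

lemma smult_closed [simp]: "c \<in> carrier F \<Longrightarrow> a \<in> carrier FG \<Longrightarrow> c \<odot>\<^bsub>FG\<^esub> a \<in> carrier FG"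
  by (auto simp: group_algebra_def)

lemma mult_closed [simp]:
  assumes "a \<in> carrier FG" "b \<in> carrier FG" shows "a \<otimes>\<^bsub>FG\<^esub> b \<in> carrier FG"
proof -
  have "(\<Oplus>\<^bsub>F\<^esub>y\<in>carrier G. a y \<otimes>\<^bsub>F\<^esub> b (inv\<^bsub>G\<^esub> y \<otimes>\<^bsub>G\<^esub> g)) \<in> carrier F" if "g \<in> carrier G" for g
    using assms that by (intro F.finsum_closed) auto
  then show ?thesis by (auto simp: group_algebra_def)
qed

lemma abelian_group_FG: "abelian_group FG"
proof (rule abelian_groupI)
  fix a assume a: "a \<in> carrier FG"
  define b where "b = (\<lambda>g\<in>carrier G. \<ominus>\<^bsub>F\<^esub> a g)"
  have "b \<in> carrier FG" using a by (auto simp: b_def carrier_FG)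
  moreover have "b \<oplus>\<^bsub>FG\<^esub> a = \<zero>\<^bsub>FG\<^esub>"
    using a \<open>b \<in> carrier FG\<close> by (intro FG_eqI) (auto simp: b_def F.l_neg)
  ultimately show "\<exists>y\<in>carrier FG. y \<oplus>\<^bsub>FG\<^esub> a = \<zero>\<^bsub>FG\<^esub>" by blast
qed (auto intro!: FG_eqI simp: F.a_ac)

text \<open>
  Every element is a sum of monomials, so additive identities in the group algebra need to be
  checked on monomials only, where convolution becomes multiplication in the group.
\<close>

lemma FG_induct [consumes 1, case_names mon add]:
  assumes f: "f \<in> carrier FG"
    and mon: "\<And>c g. \<lbrakk>c \<in> carrier F; g \<in> carrier G\<rbrakk> \<Longrightarrow> P (mon c g)"
    and add: "\<And>a b. \<lbrakk>a \<in> carrier FG; b \<in> carrier FG; P a; P b\<rbrakk> \<Longrightarrow> P (a \<oplus>\<^bsub>FG\<^esub> b)"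
  shows "P f"
proof -
  define r where "r S = (\<lambda>x\<in>carrier G. if x \<in> S then f x else \<zero>\<^bsub>F\<^esub>)" for S
  have r_closed: "r S \<in> carrier FG" for S using f by (auto simp: r_def carrier_FG)
  have "P (r S)" if "finite S" "S \<subseteq> carrier G" for S
    using that
  proof (induction S rule: finite_induct)
    case empty
    have "r {} = mon \<zero>\<^bsub>F\<^esub> \<one>\<^bsub>G\<^esub>" by (auto simp: r_def monomial_def)
    then show ?case using mon by simp
  next
    case (insert g S)
    have "r (insert g S) = mon (f g) g \<oplus>\<^bsub>FG\<^esub> r S"
    proof (rule FG_eqI)
      fix x assume "x \<in> carrier G"
      then show "r (insert g S) x = (mon (f g) g \<oplus>\<^bsub>FG\<^esub> r S) x"
        using insert f by (auto simp: r_def mon_apply)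
    qed (use insert f r_closed in auto)
    then show ?case using insert f mon add r_closed by simp
  qed
  from this[of "carrier G"] have "P (r (carrier G))" by simp
  moreover have "r (carrier G) = f"
    by (rule FG_eqI[OF r_closed f]) (simp add: r_def)
  ultimately show ?thesis by simp
qed

lemma FG_r_distr:
  assumes "a \<in> carrier FG" "b \<in> carrier FG" "c \<in> carrier FG"
  shows "a \<otimes>\<^bsub>FG\<^esub> (b \<oplus>\<^bsub>FG\<^esub> c) = a \<otimes>\<^bsub>FG\<^esub> b \<oplus>\<^bsub>FG\<^esub> a \<otimes>\<^bsub>FG\<^esub> c"
proof (rule FG_eqI)
  fix g assume g: "g \<in> carrier G"
  have "(\<Oplus>\<^bsub>F\<^esub>y\<in>carrier G. a y \<otimes>\<^bsub>F\<^esub> (b \<oplus>\<^bsub>FG\<^esub> c) (inv\<^bsub>G\<^esub> y \<otimes>\<^bsub>G\<^esub> g))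
     = (\<Oplus>\<^bsub>F\<^esub>y\<in>carrier G. a y \<otimes>\<^bsub>F\<^esub> b (inv\<^bsub>G\<^esub> y \<otimes>\<^bsub>G\<^esub> g) \<oplus>\<^bsub>F\<^esub> a y \<otimes>\<^bsub>F\<^esub> c (inv\<^bsub>G\<^esub> y \<otimes>\<^bsub>G\<^esub> g))"
    using assms g by (intro F.finsum_cong') (auto simp: F.r_distr)
  also have "\<dots> = (\<Oplus>\<^bsub>F\<^esub>y\<in>carrier G. a y \<otimes>\<^bsub>F\<^esub> b (inv\<^bsub>G\<^esub> y \<otimes>\<^bsub>G\<^esub> g))
      \<oplus>\<^bsub>F\<^esub> (\<Oplus>\<^bsub>F\<^esub>y\<in>carrier G. a y \<otimes>\<^bsub>F\<^esub> c (inv\<^bsub>G\<^esub> y \<otimes>\<^bsub>G\<^esub> g))"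
    using assms g by (intro F.finsum_addf) auto
  finally show "(a \<otimes>\<^bsub>FG\<^esub> (b \<oplus>\<^bsub>FG\<^esub> c)) g = (a \<otimes>\<^bsub>FG\<^esub> b \<oplus>\<^bsub>FG\<^esub> a \<otimes>\<^bsub>FG\<^esub> c) g"
    using g by (simp add: mult_apply)
qed (use assms in auto)

lemma FG_l_distr:
  assumes "a \<in> carrier FG" "b \<in> carrier FG" "c \<in> carrier FG"
  shows "(a \<oplus>\<^bsub>FG\<^esub> b) \<otimes>\<^bsub>FG\<^esub> c = a \<otimes>\<^bsub>FG\<^esub> c \<oplus>\<^bsub>FG\<^esub> b \<otimes>\<^bsub>FG\<^esub> c"
proof (rule FG_eqI)
  fix g assume g: "g \<in> carrier G"
  have "(\<Oplus>\<^bsub>F\<^esub>y\<in>carrier G. (a \<oplus>\<^bsub>FG\<^esub> b) y \<otimes>\<^bsub>F\<^esub> c (inv\<^bsub>G\<^esub> y \<otimes>\<^bsub>G\<^esub> g))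
     = (\<Oplus>\<^bsub>F\<^esub>y\<in>carrier G. a y \<otimes>\<^bsub>F\<^esub> c (inv\<^bsub>G\<^esub> y \<otimes>\<^bsub>G\<^esub> g) \<oplus>\<^bsub>F\<^esub> b y \<otimes>\<^bsub>F\<^esub> c (inv\<^bsub>G\<^esub> y \<otimes>\<^bsub>G\<^esub> g))"
    using assms g by (intro F.finsum_cong') (auto simp: F.l_distr)
  also have "\<dots> = (\<Oplus>\<^bsub>F\<^esub>y\<in>carrier G. a y \<otimes>\<^bsub>F\<^esub> c (inv\<^bsub>G\<^esub> y \<otimes>\<^bsub>G\<^esub> g))
      \<oplus>\<^bsub>F\<^esub> (\<Oplus>\<^bsub>F\<^esub>y\<in>carrier G. b y \<otimes>\<^bsub>F\<^esub> c (inv\<^bsub>G\<^esub> y \<otimes>\<^bsub>G\<^esub> g))"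
    using assms g by (intro F.finsum_addf) auto
  finally show "((a \<oplus>\<^bsub>FG\<^esub> b) \<otimes>\<^bsub>FG\<^esub> c) g = (a \<otimes>\<^bsub>FG\<^esub> c \<oplus>\<^bsub>FG\<^esub> b \<otimes>\<^bsub>FG\<^esub> c) g"
    using g by (simp add: mult_apply)
qed (use assms in auto)

lemma mon_mult_apply:
  assumes "c \<in> carrier F" "g \<in> carrier G" "b \<in> carrier FG" "x \<in> carrier G"
  shows "(mon c g \<otimes>\<^bsub>FG\<^esub> b) x = c \<otimes>\<^bsub>F\<^esub> b (inv\<^bsub>G\<^esub> g \<otimes>\<^bsub>G\<^esub> x)"
proof -
  have "(\<Oplus>\<^bsub>F\<^esub>y\<in>carrier G. mon c g y \<otimes>\<^bsub>F\<^esub> b (inv\<^bsub>G\<^esub> y \<otimes>\<^bsub>G\<^esub> x))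
      = (\<Oplus>\<^bsub>F\<^esub>y\<in>carrier G. if y = g then c \<otimes>\<^bsub>F\<^esub> b (inv\<^bsub>G\<^esub> g \<otimes>\<^bsub>G\<^esub> x) else \<zero>\<^bsub>F\<^esub>)"
    using assms by (intro F.finsum_cong') (auto simp: mon_apply)
  also have "\<dots> = c \<otimes>\<^bsub>F\<^esub> b (inv\<^bsub>G\<^esub> g \<otimes>\<^bsub>G\<^esub> x)"
    using assms by (intro finsum_delta) (auto intro: F.abelian_monoid_axioms)
  finally show ?thesis using assms by (simp add: mult_apply)
qed

lemma mon_mult_mon:
  assumes "c \<in> carrier F" "g \<in> carrier G" "d \<in> carrier F" "h \<in> carrier G"
  shows "mon c g \<otimes>\<^bsub>FG\<^esub> mon d h = mon (c \<otimes>\<^bsub>F\<^esub> d) (g \<otimes>\<^bsub>G\<^esub> h)"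
proof (rule FG_eqI)
  fix x assume x: "x \<in> carrier G"
  have "inv\<^bsub>G\<^esub> g \<otimes>\<^bsub>G\<^esub> x = h \<longleftrightarrow> x = g \<otimes>\<^bsub>G\<^esub> h"
    using assms x by (metis G.inv_solve_left)
  then show "(mon c g \<otimes>\<^bsub>FG\<^esub> mon d h) x = mon (c \<otimes>\<^bsub>F\<^esub> d) (g \<otimes>\<^bsub>G\<^esub> h) x"
    using assms x by (simp add: mon_mult_apply mon_apply)
qed (use assms in auto)

lemma FG_assoc:
  assumes "a \<in> carrier FG" "b \<in> carrier FG" "c \<in> carrier FG"
  shows "(a \<otimes>\<^bsub>FG\<^esub> b) \<otimes>\<^bsub>FG\<^esub> c = a \<otimes>\<^bsub>FG\<^esub> (b \<otimes>\<^bsub>FG\<^esub> c)"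
  using assms(1)
proof (induction a rule: FG_induct)
  case (mon k g)
  show ?case using assms(2)
  proof (induction b rule: FG_induct)
    case (mon l h)
    show ?case using assms(3)
    proof (induction c rule: FG_induct)
      case (mon m u)
      then show ?case
        using \<open>k \<in> carrier F\<close> \<open>g \<in> carrier G\<close> \<open>l \<in> carrier F\<close> \<open>h \<in> carrier G\<close>
        by (simp add: mon_mult_mon F.m_assoc G.m_assoc)
    next
      case (add a b)
      then show ?case
        using \<open>k \<in> carrier F\<close> \<open>l \<in> carrier F\<close> by (simp add: FG_r_distr)
    qed
  next
    case (add a b)
    then show ?case using \<open>k \<in> carrier F\<close> assms(3) by (simp add: FG_r_distr FG_l_distr)
  qed
next
  case (add a b)
  then show ?case using assms by (simp add: FG_l_distr)
qed

lemma ring_FG: "ring FG"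
proof (rule ringI)
  show "abelian_group FG" by (rule abelian_group_FG)
  show "monoid FG"
  proof (rule monoidI)
    show "\<one>\<^bsub>FG\<^esub> \<otimes>\<^bsub>FG\<^esub> a = a" if "a \<in> carrier FG" for a
      unfolding one_FG using that
      by (induction a rule: FG_induct) (simp_all add: mon_mult_mon FG_r_distr)
    show "a \<otimes>\<^bsub>FG\<^esub> \<one>\<^bsub>FG\<^esub> = a" if "a \<in> carrier FG" for a
      unfolding one_FG using that
      by (induction a rule: FG_induct) (simp_all add: mon_mult_mon FG_l_distr)
  qed (auto simp: FG_assoc one_FG)
qed (auto simp: FG_l_distr FG_r_distr)

lemma unital_algebra_FG: "unital_algebra F FG"
proof (intro unital_algebra.intro unital_algebra_axioms.intro)
  show "module F FG"
    by (rule moduleI)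
       (auto intro!: FG_eqI simp: F.cring_axioms abelian_group_FG F.l_distr F.r_distr F.m_assoc)
  show "ring FG" by (rule ring_FG)
  fix c a b assume c: "c \<in> carrier F" and a: "a \<in> carrier FG" and b: "b \<in> carrier FG"
  show "c \<odot>\<^bsub>FG\<^esub> (a \<otimes>\<^bsub>FG\<^esub> b) = a \<otimes>\<^bsub>FG\<^esub> (c \<odot>\<^bsub>FG\<^esub> b)"
  proof (rule FG_eqI)
    fix g assume g: "g \<in> carrier G"
    have "c \<otimes>\<^bsub>F\<^esub> (\<Oplus>\<^bsub>F\<^esub>y\<in>carrier G. a y \<otimes>\<^bsub>F\<^esub> b (inv\<^bsub>G\<^esub> y \<otimes>\<^bsub>G\<^esub> g))
        = (\<Oplus>\<^bsub>F\<^esub>y\<in>carrier G. c \<otimes>\<^bsub>F\<^esub> (a y \<otimes>\<^bsub>F\<^esub> b (inv\<^bsub>G\<^esub> y \<otimes>\<^bsub>G\<^esub> g)))"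
      using a b c g by (intro F.finsum_rdistr) auto
    also have "\<dots> = (\<Oplus>\<^bsub>F\<^esub>y\<in>carrier G. a y \<otimes>\<^bsub>F\<^esub> (c \<odot>\<^bsub>FG\<^esub> b) (inv\<^bsub>G\<^esub> y \<otimes>\<^bsub>G\<^esub> g))"
      using a b c g by (intro F.finsum_cong') (auto simp: F.m_lcomm)
    finally show "(c \<odot>\<^bsub>FG\<^esub> (a \<otimes>\<^bsub>FG\<^esub> b)) g = (a \<otimes>\<^bsub>FG\<^esub> (c \<odot>\<^bsub>FG\<^esub> b)) g"
      using g by (simp add: mult_apply)
  qed (use a b c in auto)
qed

sublocale FG: unital_algebra F FG by (rule unital_algebra_FG)

lemma mon_add: "\<lbrakk>c \<in> carrier F; d \<in> carrier F\<rbrakk> \<Longrightarrow> mon c g \<oplus>\<^bsub>FG\<^esub> mon d g = mon (c \<oplus>\<^bsub>F\<^esub> d) g"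
  by (intro FG_eqI) (auto simp: mon_apply)

lemma smult_mon: "\<lbrakk>c \<in> carrier F; d \<in> carrier F\<rbrakk> \<Longrightarrow> c \<odot>\<^bsub>FG\<^esub> mon d g = mon (c \<otimes>\<^bsub>F\<^esub> d) g"
  by (intro FG_eqI) (auto simp: mon_apply)

lemma augmentation_closed [simp]: "a \<in> carrier FG \<Longrightarrow> augmentation F G a \<in> carrier F"
  unfolding augmentation_def by (intro F.finsum_closed) auto

lemma augmentation_add:
  assumes "a \<in> carrier FG" "b \<in> carrier FG"
  shows "augmentation F G (a \<oplus>\<^bsub>FG\<^esub> b) = augmentation F G a \<oplus>\<^bsub>F\<^esub> augmentation F G b"
proof -
  have "augmentation F G (a \<oplus>\<^bsub>FG\<^esub> b) = (\<Oplus>\<^bsub>F\<^esub>g\<in>carrier G. a g \<oplus>\<^bsub>F\<^esub> b g)"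
    unfolding augmentation_def using assms by (intro F.finsum_cong') auto
  also have "\<dots> = augmentation F G a \<oplus>\<^bsub>F\<^esub> augmentation F G b"
    unfolding augmentation_def using assms by (intro F.finsum_addf) auto
  finally show ?thesis .
qed

lemma augmentation_mon:
  assumes "c \<in> carrier F" "g \<in> carrier G" shows "augmentation F G (mon c g) = c"
proof -
  have "augmentation F G (mon c g) = (\<Oplus>\<^bsub>F\<^esub>x\<in>carrier G. if x = g then c else \<zero>\<^bsub>F\<^esub>)"
    unfolding augmentation_def using assms by (intro F.finsum_cong') (auto simp: mon_apply)
  then show ?thesis using finsum_delta[OF F.abelian_monoid_axioms finite_G] assms by simp
qed

lemma augmentation_mult:
  assumes "a \<in> carrier FG" "b \<in> carrier FG"
  shows "augmentation F G (a \<otimes>\<^bsub>FG\<^esub> b) = augmentation F G a \<otimes>\<^bsub>F\<^esub> augmentation F G b"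
  using assms(1)
proof (induction a rule: FG_induct)
  case (mon c g)
  show ?case using assms(2)
    by (induction b rule: FG_induct)
       (use mon in \<open>simp_all add: mon_mult_mon augmentation_mon augmentation_add FG.r_distr F.r_distr\<close>)
next
  case (add a a')
  then show ?case using assms(2) by (simp add: FG.l_distr F.l_distr augmentation_add)
qed

lemma augmentation_hom: "augmentation F G \<in> ring_hom FG F"
  by (rule ring_hom_memI) (auto simp: augmentation_add augmentation_mult one_FG augmentation_mon)

end

section \<open>Functoriality of the group algebra\<close>

text \<open>
  Homomorphisms are singled out only afterwards, because sections of quotient maps, which are mere
  maps of sets, also have to be pushed forward.
\<close>

locale group_algebra_map = G: finite_group_algebra F G + Q: finite_group_algebra F Q
  for F (structure) and G (structure) and Q (structure) +
  fixes \<pi>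
  assumes map_closed [simp]: "g \<in> carrier G \<Longrightarrow> \<pi> g \<in> carrier Q"
begin

abbreviation push where "push \<equiv> pushforward F G Q \<pi>"

lemma push_closed [simp]:
  assumes "a \<in> carrier G.FG" shows "push a \<in> carrier Q.FG"
proof -
  have "(\<Oplus>\<^bsub>F\<^esub>g\<in>carrier G. if \<pi> g = q then a g else \<zero>\<^bsub>F\<^esub>) \<in> carrier F" for q
    using assms by (intro G.F.finsum_closed) auto
  then show ?thesis by (auto simp: pushforward_def Q.carrier_FG)
qed

lemma push_apply:
  "q \<in> carrier Q \<Longrightarrow> push a q = (\<Oplus>\<^bsub>F\<^esub>g\<in>carrier G. if \<pi> g = q then a g else \<zero>\<^bsub>F\<^esub>)"
  by (simp add: pushforward_def)

lemma push_add:
  assumes "a \<in> carrier G.FG" "b \<in> carrier G.FG"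
  shows "push (a \<oplus>\<^bsub>G.FG\<^esub> b) = push a \<oplus>\<^bsub>Q.FG\<^esub> push b"
proof (rule Q.FG_eqI)
  fix q assume q: "q \<in> carrier Q"
  have "push (a \<oplus>\<^bsub>G.FG\<^esub> b) q
      = (\<Oplus>\<^bsub>F\<^esub>g\<in>carrier G. (if \<pi> g = q then a g else \<zero>\<^bsub>F\<^esub>) \<oplus>\<^bsub>F\<^esub> (if \<pi> g = q then b g else \<zero>\<^bsub>F\<^esub>))"
    unfolding push_apply[OF q] using assms by (intro G.F.finsum_cong') auto
  also have "\<dots> = (push a \<oplus>\<^bsub>Q.FG\<^esub> push b) q"
    unfolding Q.add_apply[OF q] push_apply[OF q] using assms by (intro G.F.finsum_addf) auto
  finally show "push (a \<oplus>\<^bsub>G.FG\<^esub> b) q = (push a \<oplus>\<^bsub>Q.FG\<^esub> push b) q" .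
qed (use assms in auto)

lemma push_mon:
  assumes "c \<in> carrier F" "g \<in> carrier G"
  shows "push (G.mon c g) = Q.mon c (\<pi> g)"
proof (rule Q.FG_eqI)
  fix q assume q: "q \<in> carrier Q"
  have "push (G.mon c g) q
      = (\<Oplus>\<^bsub>F\<^esub>x\<in>carrier G. if x = g then (if \<pi> g = q then c else \<zero>\<^bsub>F\<^esub>) else \<zero>\<^bsub>F\<^esub>)"
    unfolding push_apply[OF q] using assms by (intro G.F.finsum_cong') (auto simp: G.mon_apply)
  also have "\<dots> = (if \<pi> g = q then c else \<zero>\<^bsub>F\<^esub>)"
    using assms by (intro finsum_delta) (auto intro: G.F.abelian_monoid_axioms)
  finally show "push (G.mon c g) q = Q.mon c (\<pi> g) q"
    using q by (auto simp: Q.mon_apply)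
qed (use assms in auto)

lemma push_smult:
  assumes "c \<in> carrier F" "a \<in> carrier G.FG"
  shows "push (c \<odot>\<^bsub>G.FG\<^esub> a) = c \<odot>\<^bsub>Q.FG\<^esub> push a"
  using assms(2)
  by (induction a rule: G.FG_induct)
     (use assms(1) in \<open>simp_all add: G.smult_mon Q.smult_mon push_mon push_add
       G.FG.smult_r_distr Q.FG.smult_r_distr\<close>)

lemma augmentation_push:
  assumes "a \<in> carrier G.FG" shows "augmentation F Q (push a) = augmentation F G a"
  using assms
  by (induction a rule: G.FG_induct)
     (simp_all add: push_mon push_add G.augmentation_mon Q.augmentation_mon
       G.augmentation_add Q.augmentation_add)

end

locale group_algebra_hom = group_algebra_map F G Q \<pi>
  for F (structure) and G (structure) and Q (structure) and \<pi> +
  assumes hom_mult: "\<lbrakk>g \<in> carrier G; h \<in> carrier G\<rbrakk> \<Longrightarrow> \<pi> (g \<otimes>\<^bsub>G\<^esub> h) = \<pi> g \<otimes>\<^bsub>Q\<^esub> \<pi> h"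
begin

lemma \<pi>_one: "\<pi> \<one>\<^bsub>G\<^esub> = \<one>\<^bsub>Q\<^esub>"
proof -
  have "group_hom G Q \<pi>"
    by (simp add: group_hom_def group_hom_axioms_def hom_def hom_mult G.G.is_group Q.G.is_group)
  then show ?thesis by (rule group_hom.hom_one)
qed

lemma push_mult:
  assumes "a \<in> carrier G.FG" "b \<in> carrier G.FG"
  shows "push (a \<otimes>\<^bsub>G.FG\<^esub> b) = push a \<otimes>\<^bsub>Q.FG\<^esub> push b"
  using assms(1)
proof (induction a rule: G.FG_induct)
  case (mon c g)
  show ?case using assms(2)
    by (induction b rule: G.FG_induct)
       (use mon in \<open>simp_all add: G.mon_mult_mon Q.mon_mult_mon push_mon push_add hom_mult
         G.FG.r_distr Q.FG.r_distr\<close>)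
next
  case (add a a')
  then show ?case using assms(2) by (simp add: G.FG.l_distr Q.FG.l_distr push_add)
qed

lemma push_algebra_hom: "push \<in> algebra_hom F G.FG Q.FG"
  by (auto simp: algebra_hom_def push_smult push_add push_mult G.one_FG Q.one_FG push_mon \<pi>_one
      intro!: ring_hom_memI)

lemma push_pow: "a \<in> carrier G.FG \<Longrightarrow> push (a [^]\<^bsub>G.FG\<^esub> (n::nat)) = push a [^]\<^bsub>Q.FG\<^esub> n"
  by (induction n) (auto simp: push_mult G.one_FG Q.one_FG push_mon \<pi>_one)

end

context finite_group_algebra
begin

text \<open>
  For \<open>k\<close> of order \<open>p\<close> this is the element \<open>x\<close> with \<open>F[\<langle>k\<rangle>] = F[x]/(x\<^sup>p)\<close>.
\<close>

definition shift where "shift k = mon \<one>\<^bsub>F\<^esub> k \<ominus>\<^bsub>FG\<^esub> \<one>\<^bsub>FG\<^esub>"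

lemma shift_closed [simp]: "shift k \<in> carrier FG"
  by (simp add: shift_def)

lemma mon_pow:
  assumes "g \<in> carrier G"
  shows "mon \<one>\<^bsub>F\<^esub> g [^]\<^bsub>FG\<^esub> (n::nat) = mon \<one>\<^bsub>F\<^esub> (g [^]\<^bsub>G\<^esub> n)"
  using assms by (induction n) (simp_all add: one_FG mon_mult_mon)

lemma shift_mult:
  assumes "a \<in> carrier FG"
  shows "shift k \<otimes>\<^bsub>FG\<^esub> a = mon \<one>\<^bsub>F\<^esub> k \<otimes>\<^bsub>FG\<^esub> a \<ominus>\<^bsub>FG\<^esub> a"
  using assms by (simp add: shift_def FG.minus_eq FG.l_distr FG.l_minus)

lemma mon_central:
  assumes k: "k \<in> carrier G" and central: "\<And>g. g \<in> carrier G \<Longrightarrow> k \<otimes>\<^bsub>G\<^esub> g = g \<otimes>\<^bsub>G\<^esub> k"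
    and c: "c \<in> carrier F" and a: "a \<in> carrier FG"
  shows "mon c k \<otimes>\<^bsub>FG\<^esub> a = a \<otimes>\<^bsub>FG\<^esub> mon c k"
  using a
  by (induction a rule: FG_induct)
     (use k c central in \<open>simp_all add: mon_mult_mon FG.l_distr FG.r_distr F.m_comm\<close>)

lemma shift_central:
  assumes k: "k \<in> carrier G" and central: "\<And>g. g \<in> carrier G \<Longrightarrow> k \<otimes>\<^bsub>G\<^esub> g = g \<otimes>\<^bsub>G\<^esub> k"
    and a: "a \<in> carrier FG"
  shows "shift k \<otimes>\<^bsub>FG\<^esub> a = a \<otimes>\<^bsub>FG\<^esub> shift k"
  using mon_central[OF k central F.one_closed a] a
  by (simp add: shift_def FG.minus_eq FG.l_distr FG.r_distr FG.l_minus FG.r_minus)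

text \<open>
  Left translation by powers of \<open>k\<close> is trivial modulo \<open>k - 1\<close>.
\<close>

lemma mon_translate:
  assumes "k \<in> carrier G" "h \<in> carrier G" "c \<in> carrier F"
  shows "\<exists>s\<in>carrier FG. mon c (k [^]\<^bsub>G\<^esub> (i::nat) \<otimes>\<^bsub>G\<^esub> h) = mon c h \<oplus>\<^bsub>FG\<^esub> shift k \<otimes>\<^bsub>FG\<^esub> s"
proof (induction i)
  case 0
  show ?case using assms by (auto intro!: bexI[of _ "\<zero>\<^bsub>FG\<^esub>"])
next
  case (Suc i)
  then obtain s where s: "s \<in> carrier FG"
    "mon c (k [^]\<^bsub>G\<^esub> i \<otimes>\<^bsub>G\<^esub> h) = mon c h \<oplus>\<^bsub>FG\<^esub> shift k \<otimes>\<^bsub>FG\<^esub> s" by blast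
  define m where "m = mon c (k [^]\<^bsub>G\<^esub> i \<otimes>\<^bsub>G\<^esub> h)"
  have m: "m \<in> carrier FG" using assms by (simp add: m_def)
  have "mon c (k [^]\<^bsub>G\<^esub> Suc i \<otimes>\<^bsub>G\<^esub> h) = mon \<one>\<^bsub>F\<^esub> k \<otimes>\<^bsub>FG\<^esub> m"
    unfolding m_def G.nat_pow_Suc2[OF assms(1)] using assms by (simp add: mon_mult_mon G.m_assoc)
  also have "\<dots> = m \<oplus>\<^bsub>FG\<^esub> shift k \<otimes>\<^bsub>FG\<^esub> m"
  proof -
    have "u \<in> carrier FG \<Longrightarrow> u = m \<oplus>\<^bsub>FG\<^esub> (u \<ominus>\<^bsub>FG\<^esub> m)" for u using m by algebra
    then show ?thesis using m by (simp add: shift_mult)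
  qed
  also have "\<dots> = mon c h \<oplus>\<^bsub>FG\<^esub> shift k \<otimes>\<^bsub>FG\<^esub> (s \<oplus>\<^bsub>FG\<^esub> m)"
  proof -
    have "(mon c h \<oplus>\<^bsub>FG\<^esub> shift k \<otimes>\<^bsub>FG\<^esub> s) \<oplus>\<^bsub>FG\<^esub> shift k \<otimes>\<^bsub>FG\<^esub> m
        = mon c h \<oplus>\<^bsub>FG\<^esub> shift k \<otimes>\<^bsub>FG\<^esub> (s \<oplus>\<^bsub>FG\<^esub> m)"
      using assms s(1) m by (simp add: FG.r_distr FG.a_assoc)
    then show ?thesis by (simp only: s(2)[folded m_def, symmetric])
  qed
  finally show ?case using s(1) m by (intro bexI[of _ "s \<oplus>\<^bsub>FG\<^esub> m"]) auto
qed

lemma add_pow_mon: "c \<in> carrier F \<Longrightarrow> add_pow FG (n::nat) (mon c g) = mon (add_pow F n c) g"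
proof (induction n)
  case 0
  show ?case by (rule FG_eqI) (auto simp: mon_apply)
next
  case (Suc n)
  then show ?case by (simp add: mon_add)
qed

lemma char_FG:
  assumes "add_pow F (n::nat) \<one>\<^bsub>F\<^esub> = \<zero>\<^bsub>F\<^esub>" shows "add_pow FG n \<one>\<^bsub>FG\<^esub> = \<zero>\<^bsub>FG\<^esub>"
proof -
  have "add_pow FG n \<one>\<^bsub>FG\<^esub> = mon \<zero>\<^bsub>F\<^esub> \<one>\<^bsub>G\<^esub>"
    using assms add_pow_mon[of "\<one>\<^bsub>F\<^esub>" n] by (simp add: one_FG)
  also have "\<dots> = \<zero>\<^bsub>FG\<^esub>" by (rule FG_eqI) (auto simp: mon_apply)
  finally show ?thesis .
qed

text \<open>
  Frobenius turns \<open>k = (k - 1) + 1\<close> into \<open>1 = (k - 1)\<^sup>q + 1\<close> for \<open>q = p\<^sup>n\<close>.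
\<close>

lemma shift_nilpotent:
  fixes p :: nat
  assumes p: "Factorial_Ring.prime p" and char: "add_pow F p \<one>\<^bsub>F\<^esub> = \<zero>\<^bsub>F\<^esub>"
    and k: "k \<in> carrier G" "k [^]\<^bsub>G\<^esub> (p ^ n) = \<one>\<^bsub>G\<^esub>"
  shows "shift k [^]\<^bsub>FG\<^esub> (p ^ n) = \<zero>\<^bsub>FG\<^esub>"
proof -
  have s: "shift k \<oplus>\<^bsub>FG\<^esub> \<one>\<^bsub>FG\<^esub> = mon \<one>\<^bsub>F\<^esub> k"
    by (simp add: shift_def FG.minus_eq FG.a_assoc FG.l_neg)
  have "(shift k \<oplus>\<^bsub>FG\<^esub> \<one>\<^bsub>FG\<^esub>) [^]\<^bsub>FG\<^esub> (p ^ n) = shift k [^]\<^bsub>FG\<^esub> (p ^ n) \<oplus>\<^bsub>FG\<^esub> \<one>\<^bsub>FG\<^esub>"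
    using FG.frobenius_power_commuting[OF p char_FG[OF char], of "shift k" "\<one>\<^bsub>FG\<^esub>" n] by simp
  then have "\<one>\<^bsub>FG\<^esub> = shift k [^]\<^bsub>FG\<^esub> (p ^ n) \<oplus>\<^bsub>FG\<^esub> \<one>\<^bsub>FG\<^esub>"
    unfolding s using k by (simp add: mon_pow one_FG)
  then show ?thesis using FG.add.l_cancel_one' [of "shift k [^]\<^bsub>FG\<^esub> (p ^ n)"] 
    by (metis FG.add.r_cancel_one' FG.nat_pow_closed FG.one_closed shift_closed)
qed

end

text \<open>
  If the fibres of \<open>\<pi>\<close> consist of translates under powers of \<open>k\<close>, with representatives chosen by
  \<open>\<sigma>\<close>, then an element of the group algebra is determined modulo \<open>k - 1\<close> by its pushforward. In
  particular \<open>k - 1\<close> generates the kernel of the pushforward.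
\<close>

lemma (in group_algebra_map) decompose_modulo_shift:
  assumes k: "k \<in> carrier G" and \<sigma>: "\<And>q. q \<in> carrier Q \<Longrightarrow> \<sigma> q \<in> carrier G"
    and fibre: "\<And>g. g \<in> carrier G \<Longrightarrow> \<exists>i::nat. g = k [^]\<^bsub>G\<^esub> i \<otimes>\<^bsub>G\<^esub> \<sigma> (\<pi> g)"
    and a: "a \<in> carrier G.FG"
  shows "\<exists>s\<in>carrier G.FG. a = pushforward F Q G \<sigma> (push a) \<oplus>\<^bsub>G.FG\<^esub> G.shift k \<otimes>\<^bsub>G.FG\<^esub> s"
proof -
  interpret \<sigma>: group_algebra_map F Q G \<sigma>
    by unfold_locales (use \<sigma> in auto)
  show ?thesis using a
  proof (induction a rule: G.FG_induct)
    case (mon c g)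
    obtain i :: nat where i: "g = k [^]\<^bsub>G\<^esub> i \<otimes>\<^bsub>G\<^esub> \<sigma> (\<pi> g)" using fibre mon by blast
    show ?case
      using G.mon_translate[OF k, of "\<sigma> (\<pi> g)" c i] mon \<sigma> by (simp add: push_mon \<sigma>.push_mon i[symmetric])
  next
    case (add a b)
    then obtain s t where st: "s \<in> carrier G.FG" "a = \<sigma>.push (push a) \<oplus>\<^bsub>G.FG\<^esub> G.shift k \<otimes>\<^bsub>G.FG\<^esub> s"
      "t \<in> carrier G.FG" "b = \<sigma>.push (push b) \<oplus>\<^bsub>G.FG\<^esub> G.shift k \<otimes>\<^bsub>G.FG\<^esub> t" by blast
    have *: "(u \<oplus>\<^bsub>G.FG\<^esub> v) \<oplus>\<^bsub>G.FG\<^esub> (u' \<oplus>\<^bsub>G.FG\<^esub> v') = (u \<oplus>\<^bsub>G.FG\<^esub> u') \<oplus>\<^bsub>G.FG\<^esub> (v \<oplus>\<^bsub>G.FG\<^esub> v')"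
      if "u \<in> carrier G.FG" "v \<in> carrier G.FG" "u' \<in> carrier G.FG" "v' \<in> carrier G.FG" for u v u' v'
      using that by (simp add: G.FG.a_ac)
    have "a \<oplus>\<^bsub>G.FG\<^esub> b = (\<sigma>.push (push a) \<oplus>\<^bsub>G.FG\<^esub> G.shift k \<otimes>\<^bsub>G.FG\<^esub> s) \<oplus>\<^bsub>G.FG\<^esub> (\<sigma>.push (push b) \<oplus>\<^bsub>G.FG\<^esub> G.shift k \<otimes>\<^bsub>G.FG\<^esub> t)"
      using st by simp
    also have "\<dots> = \<sigma>.push (push (a \<oplus>\<^bsub>G.FG\<^esub> b)) \<oplus>\<^bsub>G.FG\<^esub> G.shift k \<otimes>\<^bsub>G.FG\<^esub> (s \<oplus>\<^bsub>G.FG\<^esub> t)"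
      using add st(1,3) by (simp add: * push_add \<sigma>.push_add G.FG.r_distr)
    finally show ?case using st(1,3) by (intro bexI[of _ "s \<oplus>\<^bsub>G.FG\<^esub> t"]) auto
  qed
qed

section \<open>Group algebras of p-groups are local\<close>

text \<open>
  Class equation: conjugacy classes have \<open>p\<close>-power size and their sizes add up to a multiple of \<open>p\<close>, so
  the class of 1 cannot be the only one of size 1.
\<close>

lemma p_group_nontrivial_center:
  assumes p: "Factorial_Ring.prime p" and G: "finite_p_group p G" and nontrivial: "carrier G \<noteq> {\<one>\<^bsub>G\<^esub>}"
  obtains k where "k \<in> carrier G" "k \<noteq> \<one>\<^bsub>G\<^esub>" "\<And>g. g \<in> carrier G \<Longrightarrow> k \<otimes>\<^bsub>G\<^esub> g = g \<otimes>\<^bsub>G\<^esub> k"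
proof -
  interpret group G using G by (simp add: finite_p_group_def)
  have fin: "finite (carrier G)" using G by (simp add: finite_p_group_def)
  obtain n where n: "order G = p ^ n" using G by (auto simp: finite_p_group_def)
  let ?\<phi> = "\<lambda>g. \<lambda>h\<in>carrier G. g \<otimes>\<^bsub>G\<^esub> h \<otimes>\<^bsub>G\<^esub> inv\<^bsub>G\<^esub> g"
  interpret act: group_action G "carrier G" ?\<phi> by (rule action_by_conjugation)
  have "p dvd order G"
    using n nontrivial order_one_triv_iff by (cases n) auto
  define Orb where "Orb = orbits G (carrier G) ?\<phi>"
  have finOrb: "finite Orb" unfolding Orb_def orbits_def using fin by auto
  have part: "sum card Orb = order G"
    using act.disjoint_sum[OF fin, of "\<lambda>_. 1::nat"] by (simp add: Orb_def order_def)
  have one: "{\<one>\<^bsub>G\<^esub>} \<in> Orb"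
  proof -
    have "orbit G ?\<phi> \<one>\<^bsub>G\<^esub> = {\<one>\<^bsub>G\<^esub>}"
      using one_closed by (auto simp: orbit_def intro!: exI[of _ "\<one>\<^bsub>G\<^esub>"])
    then show ?thesis unfolding Orb_def orbits_def by (metis (mono_tags, lifting) mem_Collect_eq one_closed)
  qed
  have "\<exists>C\<in>Orb - {{\<one>\<^bsub>G\<^esub>}}. \<not> p dvd card C"
  proof (rule ccontr)
    assume "\<not> ?thesis"
    then have "p dvd sum card (Orb - {{\<one>\<^bsub>G\<^esub>}})" by (intro dvd_sum) auto
    moreover have "order G = 1 + sum card (Orb - {{\<one>\<^bsub>G\<^esub>}})"
      using part sum.remove[OF finOrb one, of card] by simp
    ultimately have "p dvd 1" using \<open>p dvd order G\<close> by (metis dvd_add_left_iff)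
    then show False using p by auto
  qed
  then obtain k where k: "k \<in> carrier G" "orbit G ?\<phi> k \<noteq> {\<one>\<^bsub>G\<^esub>}" "\<not> p dvd card (orbit G ?\<phi> k)"
    by (auto simp: Orb_def orbits_def)
  have "card (orbit G ?\<phi> k) dvd p ^ n"
    using act.orbit_stabilizer_theorem[OF k(1)] unfolding n by (rule dvdI[OF sym])
  then obtain i where "card (orbit G ?\<phi> k) = p ^ i" using divides_primepow_nat[OF p] by auto
  then have "card (orbit G ?\<phi> k) = 1" using k(3) by (cases i) auto
  then obtain y where y: "orbit G ?\<phi> k = {y}" by (rule card_1_singletonE)
  have "k \<in> orbit G ?\<phi> k" using k(1) by (rule act.orbit_refl)
  then have single: "orbit G ?\<phi> k = {k}" unfolding y by simp
  have "k \<otimes>\<^bsub>G\<^esub> g = g \<otimes>\<^bsub>G\<^esub> k" if g: "g \<in> carrier G" for g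
  proof -
    have "g \<otimes>\<^bsub>G\<^esub> k \<otimes>\<^bsub>G\<^esub> inv\<^bsub>G\<^esub> g \<in> orbit G ?\<phi> k" using g k(1) by (auto simp: orbit_def)
    then have "g \<otimes>\<^bsub>G\<^esub> k \<otimes>\<^bsub>G\<^esub> inv\<^bsub>G\<^esub> g = k" using single by simp
    then show ?thesis using g k(1) by (metis inv_solve_right' m_closed)
  qed
  moreover have "k \<noteq> \<one>\<^bsub>G\<^esub>" using k(2) single by auto
  ultimately show ?thesis using that k(1) by blast
qed

text \<open>
  Let \<open>\<pi>\<close> be the projection to the quotient by a central \<open>\<langle>k\<rangle>\<close>. The image of \<open>a\<close> in the smaller group algebra
  is nilpotent, so some power of \<open>a\<close> is a multiple of \<open>k - 1\<close>, which is central and nilpotent. To make the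
  induction possible in a fixed type, the quotient group is carried by coset representatives; it
  is then a plain monoid record over the element type of \<open>G\<close>.
\<close>

lemma augmentation_kernel_nil_step:
  fixes p :: nat and G :: "('g, 'm) monoid_scheme"
  assumes p: "Factorial_Ring.prime p" and F: "cring F" and char: "add_pow F p \<one>\<^bsub>F\<^esub> = \<zero>\<^bsub>F\<^esub>"
    and G: "finite_p_group p G" and nontrivial: "carrier G \<noteq> {\<one>\<^bsub>G\<^esub>}"
    and IH: "\<And>(Q :: 'g monoid) b. \<lbrakk>finite_p_group p Q; card (carrier Q) < card (carrier G);
      b \<in> carrier (group_algebra F Q); augmentation F Q b = \<zero>\<^bsub>F\<^esub>\<rbrakk>
      \<Longrightarrow> \<exists>m::nat. b [^]\<^bsub>group_algebra F Q\<^esub> m = \<zero>\<^bsub>group_algebra F Q\<^esub>"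
    and a: "a \<in> carrier (group_algebra F G)" "augmentation F G a = \<zero>\<^bsub>F\<^esub>"
  shows "\<exists>m::nat. a [^]\<^bsub>group_algebra F G\<^esub> m = \<zero>\<^bsub>group_algebra F G\<^esub>"
proof -
  obtain k where k: "k \<in> carrier G" "k \<noteq> \<one>\<^bsub>G\<^esub>"
    and central: "\<And>g. g \<in> carrier G \<Longrightarrow> k \<otimes>\<^bsub>G\<^esub> g = g \<otimes>\<^bsub>G\<^esub> k"
    using p_group_nontrivial_center[OF p G nontrivial] by blast
  interpret F: cring F by fact
  interpret G: group G using G by (simp add: finite_p_group_def)
  have fin: "finite (carrier G)" using G by (simp add: finite_p_group_def)
  obtain n where n: "order G = p ^ n" using G by (auto simp: finite_p_group_def)
  define N where "N = generate G {k}"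
  have N_eq: "N = {k [^]\<^bsub>G\<^esub> i |i. i \<in> (UNIV :: nat set)}"
    unfolding N_def by (rule G.generate_pow_on_finite_carrier[OF fin k(1)])
  have subN: "subgroup N G" unfolding N_def using k by (intro G.generate_is_subgroup) auto
  have pow_central: "k [^]\<^bsub>G\<^esub> i \<otimes>\<^bsub>G\<^esub> g = g \<otimes>\<^bsub>G\<^esub> k [^]\<^bsub>G\<^esub> i" if "g \<in> carrier G" for i :: nat and g
    using G.group_commutes_pow[OF central[OF that] k(1) that] .
  have "N \<lhd> G"
  proof (subst G.normal_inv_iff, intro conjI subN ballI)
    fix g h assume g: "g \<in> carrier G" and "h \<in> N"
    then obtain i :: nat where h: "h = k [^]\<^bsub>G\<^esub> i" by (auto simp: N_eq)
    have "g \<otimes>\<^bsub>G\<^esub> h \<otimes>\<^bsub>G\<^esub> inv\<^bsub>G\<^esub> g = h"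
      unfolding h pow_central[OF g, symmetric] using g k by (simp add: G.m_assoc)
    then show "g \<otimes>\<^bsub>G\<^esub> h \<otimes>\<^bsub>G\<^esub> inv\<^bsub>G\<^esub> g \<in> N" using \<open>h \<in> N\<close> by simp
  qed
  then interpret N: normal N G .
  \<comment> \<open>The quotient by \<open>N\<close>, carried by coset representatives so that its elements have the type of \<open>G\<close>.\<close>
  define rep where "rep C = (SOME x. x \<in> C)" for C :: "'g set"
  define Q where "Q = image_group rep (FactGroup G N)"
  define \<pi> where "\<pi> g = rep (N #>\<^bsub>G\<^esub> g)" for g
  have rep_in: "\<pi> g \<in> N #>\<^bsub>G\<^esub> g" if "g \<in> carrier G" for g
    unfolding \<pi>_def rep_def using G.rcos_self[OF that subN] by (rule someI)
  have \<pi>_G: "\<pi> g \<in> carrier G" if "g \<in> carrier G" for g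
    using rep_in[OF that] that subN G.r_coset_subset_G[OF subgroup.subset[OF subN] that] by auto
  have same_coset: "N #>\<^bsub>G\<^esub> \<pi> g = N #>\<^bsub>G\<^esub> g" if "g \<in> carrier G" for g
    using G.repr_independence[OF rep_in[OF that] that subN] by simp
  have carrier_Mod: "carrier (G Mod N) = (\<lambda>g. N #>\<^bsub>G\<^esub> g) ` carrier G" by (rule carrier_FactGroup)
  have inj: "inj_on rep (carrier (G Mod N))"
    unfolding carrier_Mod by (auto intro!: inj_onI simp: \<pi>_def[symmetric]) (metis same_coset)+
  have iso: "rep \<in> Group.iso (G Mod N) Q" unfolding Q_def by (rule inj_imp_image_group_iso[OF inj])
  have carrier_Q: "carrier Q = \<pi> ` carrier G"
    by (auto simp: Q_def image_group_carrier carrier_Mod \<pi>_def)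
  have groupQ: "group Q"
    unfolding Q_def by (rule group.inj_imp_image_group_is_group[OF N.factorgroup_is_group inj])
  have "\<pi> = rep \<circ> (\<lambda>g. N #>\<^bsub>G\<^esub> g)" by (auto simp: \<pi>_def)
  then have \<pi>_hom: "\<pi> \<in> hom G Q"
    using Group.hom_compose[OF N.r_coset_hom_Mod, of rep Q] iso by (simp add: Group.iso_def)
  have card_Q: "card (carrier Q) * card N = p ^ n"
  proof -
    have "card (carrier Q) = card (carrier (G Mod N))" using iso_same_order[OF iso] by (simp add: order_def)
    then show ?thesis using G.lagrange[OF subN] n by (simp add: FactGroup_def)
  qed
  have pQ: "finite_p_group p Q"
  proof -
    have "card (carrier Q) dvd p ^ n" using card_Q by (rule dvdI[OF sym])
    then show ?thesis
      using groupQ fin divides_primepow_nat[OF p] by (auto simp: finite_p_group_def carrier_Q order_def)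
  qed
  have smaller: "card (carrier Q) < card (carrier G)"
  proof -
    have "\<one>\<^bsub>G\<^esub> \<in> N" "k \<in> N" using subN by (auto simp: subgroup.one_closed N_def intro: generate.incl)
    moreover have "finite N" using fin subgroup.subset[OF subN] finite_subset by blast
    ultimately have "card {\<one>\<^bsub>G\<^esub>, k} \<le> card N" by (intro card_mono) auto
    then have "card N \<ge> 2" using k(2) by auto
    moreover have "card (carrier G) = card (carrier Q) * card N" using card_Q n by (simp add: order_def)
    moreover have "card (carrier G) > 0" using fin G.one_closed card_gt_0_iff by blast
    moreover have "card (carrier Q) * 2 \<le> card (carrier Q) * card N"
      using \<open>card N \<ge> 2\<close> by (rule mult_le_mono2)
    ultimately show ?thesis by linarith
  qed
  interpret \<pi>: group_algebra_hom F G Q \<pi>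
  proof (intro group_algebra_hom.intro group_algebra_map.intro finite_group_algebra.intro
      group_algebra_map_axioms.intro group_algebra_hom_axioms.intro finite_group_algebra_axioms.intro
      F groupQ G.is_group fin)
    show "finite (carrier Q)" using fin by (simp add: carrier_Q)
    show "\<pi> g \<in> carrier Q" if "g \<in> carrier G" for g using that by (simp add: carrier_Q)
    show "\<pi> (g \<otimes>\<^bsub>G\<^esub> h) = \<pi> g \<otimes>\<^bsub>Q\<^esub> \<pi> h" if "g \<in> carrier G" "h \<in> carrier G" for g h
      using \<pi>_hom that by (rule hom_mult)
  qed
  have fibre: "\<exists>i::nat. g = k [^]\<^bsub>G\<^esub> i \<otimes>\<^bsub>G\<^esub> \<pi> g" if g: "g \<in> carrier G" for g
  proof -
    have "g \<in> N #>\<^bsub>G\<^esub> \<pi> g" using same_coset[OF g] G.rcos_self[OF g subN] by simp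
    then show ?thesis by (auto simp: r_coset_def N_eq)
  qed
  obtain m :: nat where m: "\<pi>.push a [^]\<^bsub>\<pi>.Q.FG\<^esub> m = \<zero>\<^bsub>\<pi>.Q.FG\<^esub>"
    using IH[OF pQ smaller, of "\<pi>.push a"] a by (auto simp: \<pi>.augmentation_push)
  have am: "a [^]\<^bsub>\<pi>.G.FG\<^esub> m \<in> carrier \<pi>.G.FG" using a by simp
  interpret \<sigma>: group_algebra_map F Q G "\<lambda>q. q"
    by unfold_locales (use \<pi>_G in \<open>auto simp: carrier_Q\<close>)
  have push_zero: "\<sigma>.push \<zero>\<^bsub>\<pi>.Q.FG\<^esub> = \<zero>\<^bsub>\<pi>.G.FG\<^esub>"
    by (rule \<pi>.G.FG_eqI) (auto simp: \<sigma>.push_apply intro!: F.add.finprod_one_eqI)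
  obtain s where s: "s \<in> carrier \<pi>.G.FG" "a [^]\<^bsub>\<pi>.G.FG\<^esub> m = \<pi>.G.shift k \<otimes>\<^bsub>\<pi>.G.FG\<^esub> s"
    using \<pi>.decompose_modulo_shift[OF k(1) \<sigma>.map_closed fibre am]
    by (auto simp: \<pi>.push_pow[OF a(1)] m push_zero)
  have "k [^]\<^bsub>G\<^esub> (p ^ n) = \<one>\<^bsub>G\<^esub>" using G.pow_order_eq_1[OF k(1)] n by simp
  then have "\<pi>.G.shift k [^]\<^bsub>\<pi>.G.FG\<^esub> (p ^ n) = \<zero>\<^bsub>\<pi>.G.FG\<^esub>"
    by (rule \<pi>.G.shift_nilpotent[OF p char k(1)])
  then have "(a [^]\<^bsub>\<pi>.G.FG\<^esub> m) [^]\<^bsub>\<pi>.G.FG\<^esub> (p ^ n) = \<zero>\<^bsub>\<pi>.G.FG\<^esub>"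
    unfolding s(2) using s(1) \<pi>.G.shift_central[OF k(1) central]
    by (subst \<pi>.G.FG.pow_mult_distrib) auto
  then show ?thesis using a(1) by (auto simp: \<pi>.G.FG.nat_pow_pow)
qed

lemma augmentation_kernel_nil_trivial:
  assumes F: "cring F" and G: "group G" and trivial: "carrier G = {\<one>\<^bsub>G\<^esub>}"
    and a: "a \<in> carrier (group_algebra F G)" "augmentation F G a = \<zero>\<^bsub>F\<^esub>"
  shows "\<exists>m::nat. a [^]\<^bsub>group_algebra F G\<^esub> m = \<zero>\<^bsub>group_algebra F G\<^esub>"
proof -
  interpret finite_group_algebra F G
    using F G trivial by (auto simp: finite_group_algebra_def finite_group_algebra_axioms_def)
  have "a \<one>\<^bsub>G\<^esub> = \<zero>\<^bsub>F\<^esub>" using a by (simp add: augmentation_def trivial)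
  then have "a = \<zero>\<^bsub>FG\<^esub>" using a(1) by (intro FG_eqI) (auto simp: trivial)
  then have "a [^]\<^bsub>FG\<^esub> (1::nat) = \<zero>\<^bsub>FG\<^esub>" by simp
  then show ?thesis by blast
qed

text \<open>
  The induction runs over plain monoid records, since only these occur as quotients in the step; one more
  application of the step then reaches groups given by extended records.
\<close>

lemma augmentation_kernel_nil:
  fixes p :: nat and G :: "('g, 'm) monoid_scheme"
  assumes p: "Factorial_Ring.prime p" and F: "cring F" and char: "add_pow F p \<one>\<^bsub>F\<^esub> = \<zero>\<^bsub>F\<^esub>"
    and G: "finite_p_group p G"
    and a: "a \<in> carrier (group_algebra F G)" "augmentation F G a = \<zero>\<^bsub>F\<^esub>"
  shows "\<exists>m::nat. a [^]\<^bsub>group_algebra F G\<^esub> m = \<zero>\<^bsub>group_algebra F G\<^esub>"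
proof -
  have plain: "\<exists>m::nat. b [^]\<^bsub>group_algebra F Q\<^esub> m = \<zero>\<^bsub>group_algebra F Q\<^esub>"
    if "finite_p_group p Q" "b \<in> carrier (group_algebra F Q)" "augmentation F Q b = \<zero>\<^bsub>F\<^esub>"
    for Q :: "'g monoid" and b
    using that
  proof (induction "card (carrier Q)" arbitrary: Q b rule: less_induct)
    case less
    show ?case
    proof (cases "carrier Q = {\<one>\<^bsub>Q\<^esub>}")
      case True
      then show ?thesis
        using augmentation_kernel_nil_trivial[OF F _ True] less.prems by (simp add: finite_p_group_def)
    next
      case False
      then show ?thesis
        using augmentation_kernel_nil_step[OF p F char less.prems(1) False _ less.prems(2,3)] less.hyps
        by blast
    qed
  qed
  show ?thesis
  proof (cases "carrier G = {\<one>\<^bsub>G\<^esub>}")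
    case True
    then show ?thesis
      using augmentation_kernel_nil_trivial[OF F _ True] G a by (simp add: finite_p_group_def)
  next
    case False
    show ?thesis
      by (rule augmentation_kernel_nil_step[OF p F char G False _ a]) (rule plain)
  qed
qed

text \<open>
  An element of nonzero augmentation is a unit: after scaling it to augmentation 1, it differs
  from 1 by an element of augmentation 0, which is nilpotent. Hence a non-unit has augmentation
  0, and adding 1 makes its augmentation 1.
\<close>

lemma p_group_algebra_local:
  fixes p :: nat
  assumes p: "Factorial_Ring.prime p" and F: "field F" and char: "add_pow F p \<one>\<^bsub>F\<^esub> = \<zero>\<^bsub>F\<^esub>"
    and G: "finite_p_group p G"
    and a: "a \<in> carrier (group_algebra F G)" "a \<notin> Units (group_algebra F G)"
  shows "\<one>\<^bsub>group_algebra F G\<^esub> \<oplus>\<^bsub>group_algebra F G\<^esub> a \<in> Units (group_algebra F G)"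
proof -
  interpret F: field F by fact
  interpret finite_group_algebra F G
    using F.cring_axioms G by (auto simp: finite_group_algebra_def finite_group_algebra_axioms_def finite_p_group_def)
  have unit: "b \<in> Units FG" if b: "b \<in> carrier FG" and nz: "augmentation F G b \<noteq> \<zero>\<^bsub>F\<^esub>" for b
  proof -
    define c where "c = augmentation F G b"
    have c: "c \<in> carrier F" "c \<in> Units F" using b nz by (auto simp: c_def F.field_Units)
    define u where "u = mon (inv\<^bsub>F\<^esub> c) \<one>\<^bsub>G\<^esub> \<otimes>\<^bsub>FG\<^esub> b"
    have u: "u \<in> carrier FG" "augmentation F G u = \<one>\<^bsub>F\<^esub>"
      using b c by (auto simp: u_def augmentation_mult augmentation_mon c_def[symmetric])
    have "augmentation F G (\<one>\<^bsub>FG\<^esub> \<ominus>\<^bsub>FG\<^esub> u) = \<zero>\<^bsub>F\<^esub>"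
    proof -
      interpret hom: ring_hom_ring FG F "augmentation F G"
        using augmentation_hom by (auto intro: ring_hom_ringI2 FG.ring_axioms F.ring_axioms)
      show ?thesis using u by (simp add: FG.minus_eq F.r_neg)
    qed
    then obtain m :: nat where "(\<one>\<^bsub>FG\<^esub> \<ominus>\<^bsub>FG\<^esub> u) [^]\<^bsub>FG\<^esub> m = \<zero>\<^bsub>FG\<^esub>"
      using augmentation_kernel_nil[OF p F.cring_axioms char G, of "\<one>\<^bsub>FG\<^esub> \<ominus>\<^bsub>FG\<^esub> u"] u by auto
    then have "\<one>\<^bsub>FG\<^esub> \<ominus>\<^bsub>FG\<^esub> (\<one>\<^bsub>FG\<^esub> \<ominus>\<^bsub>FG\<^esub> u) \<in> Units FG"
      using u by (intro FG.one_minus_nilpotent_Unit) auto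
    moreover have "\<one>\<^bsub>FG\<^esub> \<ominus>\<^bsub>FG\<^esub> (\<one>\<^bsub>FG\<^esub> \<ominus>\<^bsub>FG\<^esub> u) = u" using u(1) FG.one_closed by algebra
    ultimately have "u \<in> Units FG" by simp
    moreover have "mon c \<one>\<^bsub>G\<^esub> \<in> Units FG"
    proof -
      have "mon (inv\<^bsub>F\<^esub> c) \<one>\<^bsub>G\<^esub> \<otimes>\<^bsub>FG\<^esub> mon c \<one>\<^bsub>G\<^esub> = \<one>\<^bsub>FG\<^esub>"
        "mon c \<one>\<^bsub>G\<^esub> \<otimes>\<^bsub>FG\<^esub> mon (inv\<^bsub>F\<^esub> c) \<one>\<^bsub>G\<^esub> = \<one>\<^bsub>FG\<^esub>"
        using c by (simp_all add: mon_mult_mon one_FG)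
      moreover have "mon c \<one>\<^bsub>G\<^esub> \<in> carrier FG" "mon (inv\<^bsub>F\<^esub> c) \<one>\<^bsub>G\<^esub> \<in> carrier FG" using c by simp_all
      ultimately show ?thesis unfolding Units_def by blast
    qed
    moreover have "b = mon c \<one>\<^bsub>G\<^esub> \<otimes>\<^bsub>FG\<^esub> u"
      unfolding u_def using b c
      by (simp add: FG.m_assoc[symmetric] mon_mult_mon) (simp add: one_FG[symmetric])
    ultimately show ?thesis by simp
  qed
  have "augmentation F G a = \<zero>\<^bsub>F\<^esub>" using unit a by blast
  then have "augmentation F G (\<one>\<^bsub>FG\<^esub> \<oplus>\<^bsub>FG\<^esub> a) = \<one>\<^bsub>F\<^esub>"
    using a by (simp add: augmentation_add one_FG augmentation_mon)
  then show ?thesis using a by (intro unit) auto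
qed

section \<open>A central direct factor of order p\<close>

lemma (in group) power_times_subgroup_unique:
  fixes p :: nat
  assumes S: "subgroup S G" and k: "k \<in> carrier G"
    and independent: "\<And>i. \<lbrakk>i < p; k [^] i \<in> S\<rbrakk> \<Longrightarrow> i = 0"
    and "i < p" "j < p" "q \<in> S" "q' \<in> S" "k [^] i \<otimes> q = k [^] j \<otimes> q'"
  shows "i = j \<and> q = q'"
proof -
  have cl: "u \<in> carrier G" if "u \<in> S" for u
    using that subgroup.subset[OF S] by auto
  have *: "i = j \<and> q = q'"
    if "i \<le> j" "i < p" "j < p" "q \<in> S" "q' \<in> S" "k [^] i \<otimes> q = k [^] j \<otimes> q'" for i j q q'
  proof -
    have "k [^] j = k [^] i \<otimes> k [^] (j - i)" using that k by (simp add: nat_pow_mult)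
    then have q: "q = k [^] (j - i) \<otimes> q'" using that k by (simp add: m_assoc cl)
    then have "k [^] (j - i) = q \<otimes> inv q'" using that k by (simp add: m_assoc cl)
    then have "k [^] (j - i) \<in> S"
      using that S by (simp add: subgroup.m_closed subgroup.m_inv_closed)
    then have "j - i = 0" using independent[of "j - i"] that by simp
    then show ?thesis using that q by (simp add: cl)
  qed
  show ?thesis using *[of i j q q'] *[of j i q' q] assms(4-) by (cases "i \<le> j") auto
qed

text \<open>
  \<open>P\<close> is the internal direct product of the central cyclic group \<open>{k\<^sup>i | i < p}\<close> and the subgroup \<open>S\<close>. The
  internal formulation applies directly to \<open>(\<langle>k\<rangle>S) \<times> G\<close> with its subgroup \<open>S \<times> G\<close>.
\<close>

locale cyclic_factor = finite_group_algebra F P for F (structure) and P (structure) +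
  fixes S k and p :: nat
  assumes prime_p: "Factorial_Ring.prime p" and char_p: "add_pow F p \<one>\<^bsub>F\<^esub> = \<zero>\<^bsub>F\<^esub>"
    and subgroup_S: "subgroup S P"
    and k_closed [simp]: "k \<in> carrier P"
    and k_central: "g \<in> carrier P \<Longrightarrow> k \<otimes>\<^bsub>P\<^esub> g = g \<otimes>\<^bsub>P\<^esub> k"
    and k_pow: "k [^]\<^bsub>P\<^esub> p = \<one>\<^bsub>P\<^esub>"
    and cover: "g \<in> carrier P \<Longrightarrow> \<exists>i<p. \<exists>q\<in>S. g = k [^]\<^bsub>P\<^esub> i \<otimes>\<^bsub>P\<^esub> q"
    and independent: "\<lbrakk>i < p; k [^]\<^bsub>P\<^esub> i \<in> S\<rbrakk> \<Longrightarrow> i = 0"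
begin

abbreviation Q where "Q \<equiv> P\<lparr>carrier := S\<rparr>"

lemma S_closed [simp]: "q \<in> S \<Longrightarrow> q \<in> carrier P"
  using subgroup.subset[OF subgroup_S] by auto

lemma finite_S [simp]: "finite S"
  using subgroup.subset[OF subgroup_S] finite_G by (rule finite_subset)

lemma group_Q: "group Q"
  by (rule G.subgroup_imp_group[OF subgroup_S])

lemma coordinates_unique:
  assumes "i < p" "j < p" "q \<in> S" "q' \<in> S" "k [^]\<^bsub>P\<^esub> i \<otimes>\<^bsub>P\<^esub> q = k [^]\<^bsub>P\<^esub> j \<otimes>\<^bsub>P\<^esub> q'"
  shows "i = j \<and> q = q'"
  by (rule G.power_times_subgroup_unique[OF subgroup_S k_closed independent assms])

text \<open>
  The projection of \<open>P\<close> onto the factor \<open>S\<close>.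
\<close>

definition retract where "retract g = (THE q. q \<in> S \<and> (\<exists>i<p. g = k [^]\<^bsub>P\<^esub> i \<otimes>\<^bsub>P\<^esub> q))"

lemma retract_eq:
  assumes "q \<in> S" shows "retract (k [^]\<^bsub>P\<^esub> (i::nat) \<otimes>\<^bsub>P\<^esub> q) = q"
proof -
  have p0: "p > 0" using prime_p by (rule prime_gt_0_nat)
  have "k [^]\<^bsub>P\<^esub> (p * (i div p)) = \<one>\<^bsub>P\<^esub>" using k_pow by (simp add: G.nat_pow_pow[symmetric])
  then have i: "k [^]\<^bsub>P\<^esub> i = k [^]\<^bsub>P\<^esub> (i mod p)"
    using G.nat_pow_mult[OF k_closed, of "p * (i div p)" "i mod p"] by simp
  show ?thesis unfolding retract_def i
  proof (rule the_equality)
    show "q \<in> S \<and> (\<exists>i'<p. k [^]\<^bsub>P\<^esub> (i mod p) \<otimes>\<^bsub>P\<^esub> q = k [^]\<^bsub>P\<^esub> i' \<otimes>\<^bsub>P\<^esub> q)"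
      using assms p0 by (auto intro!: exI[of _ "i mod p"])
  next
    fix q' assume "q' \<in> S \<and> (\<exists>i'<p. k [^]\<^bsub>P\<^esub> (i mod p) \<otimes>\<^bsub>P\<^esub> q = k [^]\<^bsub>P\<^esub> i' \<otimes>\<^bsub>P\<^esub> q')"
    then show "q' = q" using coordinates_unique[of "i mod p" _ q q'] assms p0 by auto
  qed
qed

lemma retract_S: "q \<in> S \<Longrightarrow> retract q = q"
  using retract_eq[of q 0] by simp

lemma retract_closed: "g \<in> carrier P \<Longrightarrow> retract g \<in> S"
  using cover[of g] retract_eq by auto

lemma retract_fibre: "g \<in> carrier P \<Longrightarrow> \<exists>i::nat. g = k [^]\<^bsub>P\<^esub> i \<otimes>\<^bsub>P\<^esub> retract g"
  using cover[of g] retract_eq by auto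

lemma retract_mult:
  assumes g: "g \<in> carrier P" and h: "h \<in> carrier P"
  shows "retract (g \<otimes>\<^bsub>P\<^esub> h) = retract g \<otimes>\<^bsub>P\<^esub> retract h"
proof -
  obtain i j :: nat where i: "g = k [^]\<^bsub>P\<^esub> i \<otimes>\<^bsub>P\<^esub> retract g" and j: "h = k [^]\<^bsub>P\<^esub> j \<otimes>\<^bsub>P\<^esub> retract h"
    using retract_fibre g h by meson
  have c: "q \<in> S" "q' \<in> S" if "q = retract g" "q' = retract h" for q q' using that g h retract_closed by auto
  have "(k [^]\<^bsub>P\<^esub> i \<otimes>\<^bsub>P\<^esub> q) \<otimes>\<^bsub>P\<^esub> (k [^]\<^bsub>P\<^esub> j \<otimes>\<^bsub>P\<^esub> q') = k [^]\<^bsub>P\<^esub> (i + j) \<otimes>\<^bsub>P\<^esub> (q \<otimes>\<^bsub>P\<^esub> q')"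
    if q: "q \<in> S" "q' \<in> S" for q q'
  proof -
    have "q \<otimes>\<^bsub>P\<^esub> k [^]\<^bsub>P\<^esub> j = k [^]\<^bsub>P\<^esub> j \<otimes>\<^bsub>P\<^esub> q"
      using G.group_commutes_pow[OF k_central[of q], of j] q by simp
    then have "q \<otimes>\<^bsub>P\<^esub> (k [^]\<^bsub>P\<^esub> j \<otimes>\<^bsub>P\<^esub> q') = k [^]\<^bsub>P\<^esub> j \<otimes>\<^bsub>P\<^esub> (q \<otimes>\<^bsub>P\<^esub> q')"
      using q by (simp add: G.m_assoc[symmetric])
    then show ?thesis using q by (simp add: G.m_assoc G.nat_pow_mult[symmetric])
  qed
  then have "g \<otimes>\<^bsub>P\<^esub> h = k [^]\<^bsub>P\<^esub> (i + j) \<otimes>\<^bsub>P\<^esub> (retract g \<otimes>\<^bsub>P\<^esub> retract h)"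
    using i j c by metis
  then show ?thesis using retract_eq subgroup.m_closed[OF subgroup_S] c by simp
qed

sublocale incl: group_algebra_hom F Q P "\<lambda>q. q"
  by (intro group_algebra_hom.intro group_algebra_map.intro finite_group_algebra.intro
      group_algebra_map_axioms.intro group_algebra_hom_axioms.intro finite_group_algebra_axioms.intro
      F.cring_axioms group_Q G.is_group finite_G) simp_all

sublocale retr: group_algebra_hom F P Q retract
  by (intro group_algebra_hom.intro group_algebra_map.intro finite_group_algebra.intro
      group_algebra_map_axioms.intro group_algebra_hom_axioms.intro finite_group_algebra_axioms.intro
      F.cring_axioms group_Q G.is_group finite_G) (simp_all add: retract_closed retract_mult)

lemma retr_incl:
  assumes "a \<in> carrier (group_algebra F Q)" shows "retr.push (incl.push a) = a"
  using assms
  by (induction a rule: incl.G.FG_induct)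
     (simp_all add: incl.push_mon retr.push_mon retract_S incl.push_add retr.push_add)

lemma incl_apply:
  assumes a: "a \<in> carrier (group_algebra F Q)" and q: "q \<in> S" and i: "i < p"
  shows "incl.push a (k [^]\<^bsub>P\<^esub> i \<otimes>\<^bsub>P\<^esub> q) = (if i = 0 then a q else \<zero>\<^bsub>F\<^esub>)"
proof -
  have eq: "s = k [^]\<^bsub>P\<^esub> i \<otimes>\<^bsub>P\<^esub> q \<longleftrightarrow> i = 0 \<and> s = q" if "s \<in> S" for s
    using coordinates_unique[of 0 i s q] that q i by auto
  have "incl.push a (k [^]\<^bsub>P\<^esub> i \<otimes>\<^bsub>P\<^esub> q)
      = (\<Oplus>\<^bsub>F\<^esub>s\<in>S. if s = k [^]\<^bsub>P\<^esub> i \<otimes>\<^bsub>P\<^esub> q then a s else \<zero>\<^bsub>F\<^esub>)"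
    using q by (simp add: incl.push_apply)
  also have "\<dots> = (\<Oplus>\<^bsub>F\<^esub>s\<in>S. if s = q then (if i = 0 then a q else \<zero>\<^bsub>F\<^esub>) else \<zero>\<^bsub>F\<^esub>)"
    using incl.G.value_closed[OF a] q by (intro F.finsum_cong') (auto simp: eq)
  also have "\<dots> = (if i = 0 then a q else \<zero>\<^bsub>F\<^esub>)"
    using incl.G.value_closed[OF a] q by (intro finsum_delta) (auto intro: F.abelian_monoid_axioms)
  finally show ?thesis .
qed

text \<open>
  The coefficients of \<open>(k - 1)\<^sup>j a\<close> on the layer \<open>k\<^sup>i S\<close> for \<open>i \<ge> j\<close>: the binomial expansion has top term \<open>k\<^sup>j a\<close>,
  and for \<open>i < p\<close> there is no wrap-around.
\<close>

lemma shift_pow_apply: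
  assumes a: "a \<in> carrier (group_algebra F Q)" and q: "q \<in> S" and "j \<le> i" "i < p"
  shows "(shift k [^]\<^bsub>FG\<^esub> j \<otimes>\<^bsub>FG\<^esub> incl.push a) (k [^]\<^bsub>P\<^esub> i \<otimes>\<^bsub>P\<^esub> q) = (if i = j then a q else \<zero>\<^bsub>F\<^esub>)"
  using assms(3,4)
proof (induction j arbitrary: i)
  case 0
  then show ?case using incl_apply[OF a q] incl.push_closed[OF a] by simp
next
  case (Suc j)
  define b where "b = shift k [^]\<^bsub>FG\<^esub> j \<otimes>\<^bsub>FG\<^esub> incl.push a"
  have ia: "incl.push a \<in> carrier FG" using incl.push_closed[OF a] .
  have b: "b \<in> carrier FG" using ia by (simp add: b_def)
  obtain i' where i': "i = Suc i'" using Suc.prems by (cases i) auto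
  define d where "d = mon \<one>\<^bsub>F\<^esub> k \<otimes>\<^bsub>FG\<^esub> b \<ominus>\<^bsub>FG\<^esub> b"
  have d: "d \<in> carrier FG" using b by (simp add: d_def)
  define g where "g = k [^]\<^bsub>P\<^esub> i \<otimes>\<^bsub>P\<^esub> q"
  have g: "g \<in> carrier P" using q by (simp add: g_def)
  have "shift k [^]\<^bsub>FG\<^esub> Suc j \<otimes>\<^bsub>FG\<^esub> incl.push a = d"
    unfolding d_def shift_mult[OF b, symmetric] FG.nat_pow_Suc2[OF shift_closed]
    unfolding b_def using ia by (simp add: FG.m_assoc)
  moreover have "d g = b (k [^]\<^bsub>P\<^esub> i' \<otimes>\<^bsub>P\<^esub> q)"
  proof -
    have "d \<oplus>\<^bsub>FG\<^esub> b = mon \<one>\<^bsub>F\<^esub> k \<otimes>\<^bsub>FG\<^esub> b"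
      using b by (simp add: d_def FG.minus_eq FG.a_assoc FG.l_neg)
    then have "d g \<oplus>\<^bsub>F\<^esub> b g = (mon \<one>\<^bsub>F\<^esub> k \<otimes>\<^bsub>FG\<^esub> b) g"
      using add_apply[OF g, of d b] by simp
    moreover have "b g = \<zero>\<^bsub>F\<^esub>" using Suc.IH[of i] Suc.prems by (simp add: b_def g_def)
    moreover have "inv\<^bsub>P\<^esub> k \<otimes>\<^bsub>P\<^esub> g = k [^]\<^bsub>P\<^esub> i' \<otimes>\<^bsub>P\<^esub> q"
      unfolding g_def i' G.nat_pow_Suc2[OF k_closed] using q by (simp add: G.m_assoc[symmetric])
    ultimately show ?thesis using b d g q by (simp add: mon_mult_apply)
  qed
  moreover have "b (k [^]\<^bsub>P\<^esub> i' \<otimes>\<^bsub>P\<^esub> q) = (if i' = j then a q else \<zero>\<^bsub>F\<^esub>)"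
    using Suc.IH[of i'] Suc.prems i' by (simp add: b_def)
  ultimately show ?case using i' by (simp add: g_def)
qed

text \<open>
  Inclusion of \<open>S\<close> and projection to \<open>S\<close> induce the constants and the evaluation at \<open>x = 0\<close>. That \<open>x\<^sup>p\<^sup>-\<^sup>1\<close> kills no
  nonzero constant \<open>a\<close> is read off from the layer \<open>k\<^sup>p\<^sup>-\<^sup>1 S\<close>, where \<open>x\<^sup>p\<^sup>-\<^sup>1 a\<close> has the coefficients of \<open>a\<close>.
\<close>

lemma truncated_extension_group_algebra:
  "truncated_extension (group_algebra F Q) FG incl.push retr.push (shift k) p"
proof (intro truncated_extension.intro truncated_extension_axioms.intro)
  show "ring (group_algebra F Q)" "ring FG" by (rule incl.G.ring_FG, rule ring_FG)
  show "incl.push \<in> ring_hom (group_algebra F Q) FG" "retr.push \<in> ring_hom FG (group_algebra F Q)"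
    using incl.push_algebra_hom retr.push_algebra_hom by (auto simp: algebra_hom_def)
  show "retr.push (incl.push a) = a" if "a \<in> carrier (group_algebra F Q)" for a
    using that by (rule retr_incl)
  show "shift k \<otimes>\<^bsub>FG\<^esub> r = r \<otimes>\<^bsub>FG\<^esub> shift k" if "r \<in> carrier FG" for r
    using k_closed k_central that by (rule shift_central)
  show "p > 0" using prime_p by (rule prime_gt_0_nat)
  show "shift k [^]\<^bsub>FG\<^esub> p = \<zero>\<^bsub>FG\<^esub>"
    using shift_nilpotent[OF prime_p char_p k_closed, of 1] k_pow by simp
  show "retr.push (shift k) = \<zero>\<^bsub>group_algebra F Q\<^esub>"
  proof -
    interpret r: ring_hom_ring FG "group_algebra F Q" retr.push
      using retr.push_algebra_hom
      by (auto intro: ring_hom_ringI2 FG.ring_axioms incl.G.ring_FG simp: algebra_hom_def)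
    have "retract k = \<one>\<^bsub>P\<^esub>"
      using retract_eq[OF subgroup.one_closed[OF subgroup_S], of 1] by simp
    then show ?thesis
      by (simp add: shift_def FG.minus_eq retr.push_mon incl.G.one_FG incl.G.FG.r_neg)
  qed
  show "\<exists>s\<in>carrier FG. r = shift k \<otimes>\<^bsub>FG\<^esub> s"
    if r: "r \<in> carrier FG" "retr.push r = \<zero>\<^bsub>group_algebra F Q\<^esub>" for r
  proof -
    have "incl.push \<zero>\<^bsub>group_algebra F Q\<^esub> = \<zero>\<^bsub>FG\<^esub>"
      by (rule FG_eqI) (auto simp: incl.push_apply intro!: F.add.finprod_one_eqI)
    then show ?thesis
      using retr.decompose_modulo_shift[of k "\<lambda>q. q" r] retract_fibre r by auto
  qed
  show "a = \<zero>\<^bsub>group_algebra F Q\<^esub>"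
    if a: "a \<in> carrier (group_algebra F Q)" "shift k [^]\<^bsub>FG\<^esub> (p - 1) \<otimes>\<^bsub>FG\<^esub> incl.push a = \<zero>\<^bsub>FG\<^esub>" for a
  proof (rule incl.G.FG_eqI)
    fix q assume "q \<in> carrier Q"
    then have "q \<in> S" by simp
    then show "a q = \<zero>\<^bsub>group_algebra F Q\<^esub> q"
      using shift_pow_apply[OF a(1), of q "p - 1" "p - 1"] a(2) prime_gt_0_nat[OF prime_p] by simp
  qed (use a in auto)
qed simp

end

lemma cyclic_factor_cancel:
  assumes field: "field F"
    and P: "cyclic_factor F P S k p" and P': "cyclic_factor F P' S' k' p"
    and Q: "finite_p_group p (P\<lparr>carrier := S\<rparr>)" and Q': "finite_p_group p (P'\<lparr>carrier := S'\<rparr>)"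
    and iso: "algebra_isomorphic F (group_algebra F P) (group_algebra F P')"
  shows "algebra_isomorphic F (group_algebra F (P\<lparr>carrier := S\<rparr>)) (group_algebra F (P'\<lparr>carrier := S'\<rparr>))"
proof -
  interpret P: cyclic_factor F P S k p by fact
  interpret P': cyclic_factor F P' S' k' p by fact
  show ?thesis
  proof (rule truncated_extension_cancel[OF P.prime_p P.char_FG[OF P.char_p]
        P.incl.G.unital_algebra_FG P'.incl.G.unital_algebra_FG P'.unital_algebra_FG
        P.truncated_extension_group_algebra P'.truncated_extension_group_algebra
        P.incl.push_algebra_hom P'.incl.push_algebra_hom _ _ iso])
  qed (rule p_group_algebra_local[OF P.prime_p field P.char_p]; use Q Q' in blast)+
qed

section \<open>Cancelling an elementary abelian factor\<close>

lemma algebra_isomorphic_trans: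
  assumes "algebra_isomorphic F A B" "algebra_isomorphic F B C"
  shows "algebra_isomorphic F A C"
proof -
  obtain f g where fg: "f \<in> algebra_iso F A B" "g \<in> algebra_iso F B C"
    using assms by (auto simp: algebra_isomorphic_def)
  then have "g \<circ> f \<in> ring_iso A C" by (auto simp: algebra_iso_def intro: ring_iso_set_trans)
  moreover have "f a \<in> carrier B" if "a \<in> carrier A" for a
    using fg(1) that by (auto simp: algebra_iso_def ring_iso_def dest: ring_hom_closed)
  ultimately have "g \<circ> f \<in> algebra_iso F A C" using fg by (auto simp: algebra_iso_def)
  then show ?thesis by (auto simp: algebra_isomorphic_def)
qed

lemma group_algebra_cong:
  assumes F: "cring F" and G: "group G" "finite (carrier G)" and H: "group H" "finite (carrier H)"
    and \<pi>: "\<pi> \<in> Group.iso G H"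
  shows "algebra_isomorphic F (group_algebra F G) (group_algebra F H)"
proof -
  have bij: "bij_betw \<pi> (carrier G) (carrier H)" and hom: "\<pi> \<in> hom G H"
    using \<pi> by (auto simp: Group.iso_def)
  define \<sigma> where "\<sigma> = inv_into (carrier G) \<pi>"
  have \<sigma>: "\<sigma> h \<in> carrier G" "\<pi> (\<sigma> h) = h" if "h \<in> carrier H" for h
    using bij that by (auto simp: \<sigma>_def bij_betw_def intro: inv_into_into f_inv_into_f)
  have \<sigma>\<pi>: "\<sigma> (\<pi> g) = g" if "g \<in> carrier G" for g
    using bij that by (simp add: \<sigma>_def bij_betw_def)
  interpret \<pi>: group_algebra_hom F G H \<pi>
    by (intro group_algebra_hom.intro group_algebra_map.intro finite_group_algebra.intro
        group_algebra_map_axioms.intro group_algebra_hom_axioms.intro finite_group_algebra_axioms.intro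
        F G H) (use hom in \<open>auto simp: hom_def\<close>)
  interpret \<sigma>: group_algebra_map F H G \<sigma>
    by unfold_locales (rule \<sigma>(1))
  have 1: "\<sigma>.push (\<pi>.push a) = a" if "a \<in> carrier \<pi>.G.FG" for a
    using that by (induction a rule: \<pi>.G.FG_induct)
      (simp_all add: \<pi>.push_mon \<sigma>.push_mon \<sigma>\<pi> \<pi>.push_add \<sigma>.push_add)
  have 2: "\<pi>.push (\<sigma>.push b) = b" if "b \<in> carrier \<pi>.Q.FG" for b
    using that by (induction b rule: \<pi>.Q.FG_induct)
      (simp_all add: \<pi>.push_mon \<sigma>.push_mon \<sigma> \<pi>.push_add \<sigma>.push_add)
  have "bij_betw \<pi>.push (carrier \<pi>.G.FG) (carrier \<pi>.Q.FG)"
    by (rule bij_betw_byWitness[where f' = \<sigma>.push]) (auto simp: 1 2)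
  then have "\<pi>.push \<in> algebra_iso F \<pi>.G.FG \<pi>.Q.FG"
    using \<pi>.push_algebra_hom by (auto simp: algebra_iso_def algebra_hom_def ring_iso_def)
  then show ?thesis by (auto simp: algebra_isomorphic_def)
qed

text \<open>
  If \<open>p = m l\<close>, then the product of \<open>m \<cdot> 1\<close> and \<open>l \<cdot> 1\<close> vanishes, so one of them does.
\<close>

lemma field_characteristic_prime:
  assumes "field F" "ring_characteristic F = p" "p > 0"
  shows "Factorial_Ring.prime p" "add_pow F p \<one>\<^bsub>F\<^esub> = \<zero>\<^bsub>F\<^esub>"
proof -
  interpret field F by fact
  have ord: "add_pow F n \<one>\<^bsub>F\<^esub> = \<zero>\<^bsub>F\<^esub> \<longleftrightarrow> p dvd n" for n :: nat
    using add.pow_eq_id[OF one_closed, of n] assms(2) by (simp add: ring_characteristic_def add_pow_def)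
  show "add_pow F p \<one>\<^bsub>F\<^esub> = \<zero>\<^bsub>F\<^esub>" by (simp add: ord)
  have "p \<noteq> 1" using ord[of 1] by auto
  moreover have "m = 1 \<or> m = p" if m: "m dvd p" for m
  proof -
    obtain l where l: "p = m * l" using m by auto
    have "add_pow F m \<one>\<^bsub>F\<^esub> \<otimes>\<^bsub>F\<^esub> add_pow F l \<one>\<^bsub>F\<^esub> = add_pow F p \<one>\<^bsub>F\<^esub>"
      unfolding l by (simp add: add_pow_ldistr add_pow_rdistr add.nat_pow_pow mult.commute)
    then have "add_pow F m \<one>\<^bsub>F\<^esub> = \<zero>\<^bsub>F\<^esub> \<or> add_pow F l \<one>\<^bsub>F\<^esub> = \<zero>\<^bsub>F\<^esub>"
      using ord[of p] by (intro integral) auto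
    then have "p dvd m \<or> p dvd l" by (simp add: ord)
    then show ?thesis using l assms(3) m by (auto simp: dvd_mult_cancel_left dest: dvd_antisym)
  qed
  ultimately show "Factorial_Ring.prime p" using assms(3) by (simp add: prime_nat_iff)
qed

text \<open>
  Enlarging a subgroup \<open>S\<close> of \<open>E\<close> by one element outside it splits off a cyclic factor. Climbing
  in this way leads from the trivial subgroup to \<open>E\<close>.
\<close>

locale elementary_abelian_extension =
  fixes E (structure) and S k and p :: nat
  assumes prime_p: "Factorial_Ring.prime p"
    and E: "elementary_abelian p E" and finite_E: "finite (carrier E)"
    and S: "subgroup S E" and k: "k \<in> carrier E" "k \<notin> S"
begin

sublocale comm_group E using E by (simp add: elementary_abelian_def)

definition "T = (\<lambda>(i, s). k [^] i \<otimes> s) ` ({..<p} \<times> S)"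

lemma S_closed: "s \<in> S \<Longrightarrow> s \<in> carrier E"
  using subgroup.subset[OF S] by auto

lemma k_pow: "k [^] p = \<one>"
  using E k by (simp add: elementary_abelian_def)

lemma pow_mod: "k [^] (i mod p) = k [^] (i::nat)"
proof -
  have "k [^] (p * (i div p)) = \<one>" using k_pow k(1) by (simp add: nat_pow_pow[symmetric])
  then show ?thesis using nat_pow_mult[OF k(1), of "p * (i div p)" "i mod p"] k(1) by simp
qed

lemma TI: "s \<in> S \<Longrightarrow> k [^] (i::nat) \<otimes> s \<in> T"
  using prime_gt_0_nat[OF prime_p] unfolding T_def
  by (intro image_eqI[of _ _ "(i mod p, s)"]) (auto simp: pow_mod)

lemma TE:
  assumes "t \<in> T" obtains i s where "i < p" "s \<in> S" "t = k [^] i \<otimes> s"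
  using assms by (auto simp: T_def)

lemma subgroup_T: "subgroup T E"
proof (rule subgroupI)
  show "T \<subseteq> carrier E" using k S_closed by (auto simp: T_def)
  show "T \<noteq> {}" using TI[OF subgroup.one_closed[OF S]] by blast
  fix a assume "a \<in> T"
  then obtain i s where a: "i < p" "s \<in> S" "a = k [^] i \<otimes> s" by (rule TE)
  have "k [^] (p - i) \<otimes> k [^] i = \<one>" using a(1) k(1) k_pow by (simp add: nat_pow_mult)
  then have "inv (k [^] i) = k [^] (p - i)" using k(1) by (intro inv_equality) auto
  then have "inv a = k [^] (p - i) \<otimes> inv s"
    using a k(1) S_closed by (simp add: inv_mult)
  then show "inv a \<in> T" using TI subgroup.m_inv_closed[OF S a(2)] by simp
  fix b assume "b \<in> T"
  then obtain j t where b: "j < p" "t \<in> S" "b = k [^] j \<otimes> t" by (rule TE)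
  have "a \<otimes> b = k [^] (i + j) \<otimes> (s \<otimes> t)"
    using a b k(1) S_closed by (simp add: nat_pow_mult[symmetric] m_ac)
  then show "a \<otimes> b \<in> T" using TI subgroup.m_closed[OF S a(2) b(2)] by simp
qed

text \<open>
  An exponent \<open>i\<close> prime to \<open>p\<close> is invertible modulo \<open>p\<close>, so \<open>k\<^sup>i \<in> S\<close> would put \<open>k\<close> itself in \<open>S\<close>.
\<close>

lemma independent:
  assumes "i < p" "k [^] i \<in> S" shows "i = 0"
proof (rule ccontr)
  assume "i \<noteq> 0"
  then have "coprime i p"
    using prime_p assms(1) by (metis coprime_commute nat_dvd_not_less neq0_conv prime_imp_coprime_nat)
  then obtain j l where "i * j = p * l + 1"
    using bezout_nat[OF \<open>i \<noteq> 0\<close>, of p] by (auto simp: coprime_iff_gcd_eq_1)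
  then have "(k [^] i) [^] j = k"
    using k(1) k_pow nat_pow_pow[OF k(1), of p l] by (simp add: nat_pow_pow nat_pow_mult[symmetric])
  moreover have "(k [^] i) [^] j \<in> S"
    using assms(2) by (induction j) (auto intro: subgroup.one_closed[OF S] subgroup.m_closed[OF S])
  ultimately show False using k(2) by simp
qed

lemma k_in_T: "k \<in> T"
  using TI[OF subgroup.one_closed[OF S], of 1] k(1) by (simp add: nat_pow_eone)

lemma S_subset_T: "S \<subseteq> T"
  using TI[of _ 0] S_closed by auto

lemma cyclic_factor_DirProd:
  assumes F: "cring F" "add_pow F p \<one>\<^bsub>F\<^esub> = \<zero>\<^bsub>F\<^esub>" and G: "group G" "finite (carrier G)"
  shows "cyclic_factor F (E\<lparr>carrier := T\<rparr> \<times>\<times> G) (S \<times> carrier G) (k, \<one>\<^bsub>G\<^esub>) p"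
proof -
  interpret G: group G by fact
  interpret ET: group "E\<lparr>carrier := T\<rparr>" by (rule subgroup_imp_group[OF subgroup_T])
  let ?P = "E\<lparr>carrier := T\<rparr> \<times>\<times> G"
  have group_P: "group ?P" by (rule DirProd_group[OF ET.is_group G(1)])
  have pow: "(k, \<one>\<^bsub>G\<^esub>) [^]\<^bsub>?P\<^esub> (n::nat) = (k [^] n, \<one>\<^bsub>G\<^esub>)" for n
    by (induction n) auto
  have T_carrier: "t \<in> carrier E" if "t \<in> T" for t using that subgroup.subset[OF subgroup_T] by auto
  show ?thesis
  proof (intro cyclic_factor.intro finite_group_algebra.intro finite_group_algebra_axioms.intro
      cyclic_factor_axioms.intro F prime_p group_P)
    show "finite (carrier ?P)"
      using G(2) finite_subset[OF subgroup.subset[OF subgroup_T] finite_E] by simp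
    show "subgroup (S \<times> carrier G) ?P"
    proof (rule DirProd_subgroups[OF ET.is_group _ G(1) G.subgroup_self])
      show "subgroup S (E\<lparr>carrier := T\<rparr>)"
        by (rule subgroup_incl[OF S subgroup_T S_subset_T])
    qed
    show "(k, \<one>\<^bsub>G\<^esub>) \<in> carrier ?P" using k_in_T by simp
    show "(k, \<one>\<^bsub>G\<^esub>) \<otimes>\<^bsub>?P\<^esub> g = g \<otimes>\<^bsub>?P\<^esub> (k, \<one>\<^bsub>G\<^esub>)" if "g \<in> carrier ?P" for g
      using that k(1) by (auto simp: m_comm T_carrier)
    show "(k, \<one>\<^bsub>G\<^esub>) [^]\<^bsub>?P\<^esub> p = \<one>\<^bsub>?P\<^esub>" by (simp add: pow k_pow)
    show "\<exists>i<p. \<exists>q\<in>S \<times> carrier G. g = (k, \<one>\<^bsub>G\<^esub>) [^]\<^bsub>?P\<^esub> i \<otimes>\<^bsub>?P\<^esub> q" if g: "g \<in> carrier ?P" for g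
    proof -
      obtain t u where tu: "g = (t, u)" "t \<in> T" "u \<in> carrier G" using g by auto
      then obtain i s where "i < p" "s \<in> S" "t = k [^] i \<otimes> s" by (meson TE)
      then show ?thesis using tu by (auto simp: pow intro!: exI[of _ i] bexI[of _ "(s, u)"])
    qed
    show "i = 0" if "i < p" "(k, \<one>\<^bsub>G\<^esub>) [^]\<^bsub>?P\<^esub> i \<in> S \<times> carrier G" for i
      using that by (intro independent) (auto simp: pow)
  qed
qed

lemma card_T: "card T = p * card S"
proof -
  have "inj_on (\<lambda>(i, s). k [^] i \<otimes> s) ({..<p} \<times> S)"
  proof (rule inj_onI)
    fix u v assume uv: "u \<in> {..<p} \<times> S" "v \<in> {..<p} \<times> S"
      "(case u of (i, s) \<Rightarrow> k [^] i \<otimes> s) = (case v of (i, s) \<Rightarrow> k [^] i \<otimes> s)"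
    obtain i s j t where "u = (i, s)" "v = (j, t)" by (cases u, cases v)
    then show "u = v" using uv power_times_subgroup_unique[OF S k(1) independent, where i = i and j = j and q = s and q' = t]
      by auto
  qed
  then show ?thesis unfolding T_def by (simp add: card_image card_cartesian_product)
qed

end

text \<open>
  The implication to be proved, for a subgroup \<open>S\<close> in place of \<open>E\<close>, is trivial for \<open>S = 1\<close> and passes
  from \<open>S\<close> to \<open>\<langle>k\<rangle>S\<close> by cancelling \<open>k\<close>. The order of \<open>S\<close> is carried along as a power of \<open>p\<close> so that
  \<open>S \<times> G\<close> and \<open>S \<times> H\<close> are \<open>p\<close>-groups and have local group algebras.
\<close>

theorem theorem1:
  fixes F :: "('f, 'k) ring_scheme"
    and E :: "('e, 'l) monoid_scheme"
    and G :: "('g, 'm) monoid_scheme"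
    and H :: "('h, 'n) monoid_scheme"
    and p :: nat
  assumes "field F" and "ring_characteristic F = p" and "p > 0"
    and "finite_p_group p G" and "finite_p_group p H"
    and "elementary_abelian p E" and "finite (carrier E)"
    and "algebra_isomorphic F (group_algebra F (E \<times>\<times> G)) (group_algebra F (E \<times>\<times> H))"
  shows "algebra_isomorphic F (group_algebra F G) (group_algebra F H)"
proof -
  interpret F: field F by fact
  interpret E: comm_group E using assms(6) by (simp add: elementary_abelian_def)
  interpret G: group G using assms(4) by (simp add: finite_p_group_def)
  interpret H: group H using assms(5) by (simp add: finite_p_group_def)
  have fin: "finite (carrier G)" "finite (carrier H)" using assms(4,5) by (auto simp: finite_p_group_def)
  have p: "Factorial_Ring.prime p" and char: "add_pow F p \<one>\<^bsub>F\<^esub> = \<zero>\<^bsub>F\<^esub>"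
    using field_characteristic_prime[OF assms(1-3)] by auto
  let ?E = "\<lambda>S. E\<lparr>carrier := S\<rparr>"
  define good where "good S \<longleftrightarrow> subgroup S E \<and> (\<exists>n. card S = p ^ n) \<and>
    (algebra_isomorphic F (group_algebra F (?E S \<times>\<times> G)) (group_algebra F (?E S \<times>\<times> H)) \<longrightarrow>
     algebra_isomorphic F (group_algebra F G) (group_algebra F H))" for S
  have p_group: "finite_p_group p (?E S \<times>\<times> K)"
    if "subgroup S E" "card S = p ^ n" "finite_p_group p K" for S n and K :: "('x, 'y) monoid_scheme"
  proof -
    have "finite S" using that(1) assms(7) subgroup.subset finite_subset by metis
    moreover have "group (?E S)" by (rule E.subgroup_imp_group[OF that(1)])
    ultimately show ?thesis using that(2,3)
      by (auto simp: finite_p_group_def order_def card_cartesian_product DirProd_group power_add[symmetric])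
  qed
  have good_one: "good {\<one>\<^bsub>E\<^esub>}"
  proof -
    have sub: "subgroup {\<one>\<^bsub>E\<^esub>} E" by (rule E.triv_subgroup)
    have E1: "group (?E {\<one>\<^bsub>E\<^esub>})" by (rule E.subgroup_imp_group[OF sub])
    have "algebra_isomorphic F (group_algebra F G) (group_algebra F (?E {\<one>\<^bsub>E\<^esub>} \<times>\<times> G))"
    proof (rule group_algebra_cong[OF F.cring_axioms G.is_group fin(1) DirProd_group[OF E1 G.is_group]])
      show "(\<lambda>g. (\<one>\<^bsub>E\<^esub>, g)) \<in> Group.iso G (?E {\<one>\<^bsub>E\<^esub>} \<times>\<times> G)"
        by (auto simp: Group.iso_def hom_def bij_betw_def inj_on_def)
    qed (use fin in simp)
    moreover have "algebra_isomorphic F (group_algebra F (?E {\<one>\<^bsub>E\<^esub>} \<times>\<times> H)) (group_algebra F H)"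
    proof (rule group_algebra_cong[OF F.cring_axioms DirProd_group[OF E1 H.is_group] _ H.is_group fin(2)])
      show "snd \<in> Group.iso (?E {\<one>\<^bsub>E\<^esub>} \<times>\<times> H) H"
        by (auto simp: Group.iso_def hom_def bij_betw_def inj_on_def image_iff)
    qed (use fin in simp)
    ultimately show ?thesis
      unfolding good_def using sub algebra_isomorphic_trans
      by (metis card_1_singleton_iff One_nat_def power_0)
  qed
  have good_extend: "\<exists>T. good T \<and> card S < card T" if S: "good S" "S \<noteq> carrier E" for S
  proof -
    have subS: "subgroup S E" using S(1) by (simp add: good_def)
    then obtain k where k: "k \<in> carrier E" "k \<notin> S" using S(2) subgroup.subset by blast
    interpret ext: elementary_abelian_extension E S k p
      by (rule elementary_abelian_extension.intro[OF p assms(6,7) subS k])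
    obtain n where n: "card S = p ^ n" using S(1) by (auto simp: good_def)
    have "algebra_isomorphic F (group_algebra F (?E S \<times>\<times> G)) (group_algebra F (?E S \<times>\<times> H))"
      if iso: "algebra_isomorphic F (group_algebra F (?E ext.T \<times>\<times> G)) (group_algebra F (?E ext.T \<times>\<times> H))"
    proof -
      have eq: "(?E ext.T \<times>\<times> K)\<lparr>carrier := S \<times> carrier K\<rparr> = ?E S \<times>\<times> K" for K :: "('x, 'y) monoid_scheme"
        by (simp add: DirProd_def)
      show ?thesis
        using cyclic_factor_cancel[OF assms(1)
          ext.cyclic_factor_DirProd[OF F.cring_axioms char G.is_group fin(1)]
          ext.cyclic_factor_DirProd[OF F.cring_axioms char H.is_group fin(2)] _ _ iso]
          p_group[OF subS n assms(4)] p_group[OF subS n assms(5)]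
        by (simp add: eq)
    qed
    moreover have "card ext.T = p ^ Suc n" by (simp add: ext.card_T n)
    ultimately have "good ext.T" using S(1) ext.subgroup_T unfolding good_def by blast
    moreover have "card S < card ext.T"
      using n prime_gt_1_nat[OF p] by (simp add: ext.card_T)
    ultimately show ?thesis by blast
  qed
  have "good (carrier E)"
  proof (rule ccontr)
    assume contra: "\<not> good (carrier E)"
    \<comment> \<open>Otherwise good subgroups could be enlarged indefinitely, beyond the order of \<open>E\<close>.\<close>
    have "\<exists>S. good S \<and> card S \<ge> m" for m
    proof (induction m)
      case 0
      show ?case using good_one by blast
    next
      case (Suc m)
      then show ?case using good_extend contra by (metis Suc_leI le_less_trans)
    qed
    then obtain S where "good S" "card S \<ge> Suc (card (carrier E))" by blast
    moreover from this have "card S \<le> card (carrier E)"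
      using assms(7) by (intro card_mono) (simp_all add: good_def subgroup.subset)
    ultimately show False by simp
  qed
  then show ?thesis using assms(8) by (simp add: good_def)
qed

end
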